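(* Let $R$ be an integral domain. The following conditions are equivalent: (i) $R$ is a generalized Krull domain; (ii) $R$ is a strongly discrete P$v$MD satisfying the $t\#\#$-property; (iii) $R$ is a strongly discrete P$v$MD satisfying the $tRTP$-property.
   Context: $R$ is an integral domain with quotient field $K\neq R$. For nonzero $R$-submodules $A,B$ of $K$, $(A:B)=\{x\in K: xB\subseteq A\}$. For a nonzero fractional ideal $I$, $I_v=(R:(R:I))$, $I_t=\bigcup\{J_v: J\subseteq I\text{ nonzero finitely generated}\}$; $I$ is a $t$-ideal if $I=I_t$; a $t$-prime is a prime $t$-ideal; a $t$-maximal ideal is an ideal maximal among proper $t$-ideals. $R$ is a P$v$MD if $R_M$ is a valuation domain for every $t$-maximal $M$. A P$v$MD is strongly discrete if $(P^2)_t\neq P$ for each $t$-prime $P$ (equivalently, $R_P$ is a valuation domain with no nonzero idempotent prime ideal for each $t$-prime $P$). A generalized Krull domain is a strongly discrete P$v$MD satisfying the ascending chain condition on radical $t$-ideals. $R$ has the $t\#\#$-property if $\bigcap_{P\in\mathcal P_1}R_P\neq\bigcap_{P\in\mathcal P_2}R_P$ for any two distinct sets $\mathcal P_1,\mathcal P_2$ of pairwise incomparable $t$-primes. $R$ has the $tRTP$-property if for each nonzero ideal $I$, either $(I(R:I))_t=R$ or $(I(R:I))_t$ is a radical ideal. *)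

theory Defs
  imports Main
begin

text \<open>Convention: the integral domain R is represented as a subring of a field K
  (the type 'k) such that K is the quotient field of R.\<close>

definition domain_with_qf :: "'k::field set \<Rightarrow> bool" where
  "domain_with_qf R \<longleftrightarrow> 0 \<in> R \<and> 1 \<in> R \<and>
     (\<forall>a\<in>R. \<forall>b\<in>R. a + b \<in> R \<and> a * b \<in> R \<and> - a \<in> R) \<and>
     (\<forall>x. \<exists>a\<in>R. \<exists>b\<in>R. b \<noteq> 0 \<and> x = a / b)"

definition submod :: "'k::field set \<Rightarrow> 'k set \<Rightarrow> bool" where
  "submod R A \<longleftrightarrow> 0 \<in> A \<and> (\<forall>a\<in>A. \<forall>b\<in>A. a + b \<in> A) \<and> (\<forall>r\<in>R. \<forall>a\<in>A. r * a \<in> A)"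

definition colon :: "'k::field set \<Rightarrow> 'k set \<Rightarrow> 'k set" where
  "colon A B = {x. \<forall>b\<in>B. x * b \<in> A}"

definition rspan :: "'k::field set \<Rightarrow> 'k set \<Rightarrow> 'k set" where
  "rspan R S = {\<Sum>x\<in>F. c x * x | F c. finite F \<and> F \<subseteq> S \<and> (\<forall>x\<in>F. c x \<in> R)}"

definition mprod :: "'k::field set \<Rightarrow> 'k set \<Rightarrow> 'k set \<Rightarrow> 'k set" where
  "mprod R A B = rspan R {a * b | a b. a \<in> A \<and> b \<in> B}"

definition v_op :: "'k::field set \<Rightarrow> 'k set \<Rightarrow> 'k set" where
  "v_op R I = colon R (colon R I)"

definition t_op :: "'k::field set \<Rightarrow> 'k set \<Rightarrow> 'k set" where
  "t_op R I = \<Union>{v_op R J | J. \<exists>F. finite F \<and> F \<subseteq> I \<and> J = rspan R F \<and> J \<noteq> {0}}"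

definition is_ideal :: "'k::field set \<Rightarrow> 'k set \<Rightarrow> bool" where
  "is_ideal R I \<longleftrightarrow> I \<subseteq> R \<and> submod R I"

definition prime_ideal :: "'k::field set \<Rightarrow> 'k set \<Rightarrow> bool" where
  "prime_ideal R P \<longleftrightarrow> is_ideal R P \<and> P \<noteq> R \<and>
     (\<forall>a\<in>R. \<forall>b\<in>R. a * b \<in> P \<longrightarrow> a \<in> P \<or> b \<in> P)"

definition radical_ideal :: "'k::field set \<Rightarrow> 'k set \<Rightarrow> bool" where
  "radical_ideal R I \<longleftrightarrow> is_ideal R I \<and> (\<forall>x\<in>R. \<forall>n::nat. x ^ n \<in> I \<longrightarrow> x \<in> I)"

definition t_ideal :: "'k::field set \<Rightarrow> 'k set \<Rightarrow> bool" where
  "t_ideal R I \<longleftrightarrow> is_ideal R I \<and> I \<noteq> {0} \<and> t_op R I = I"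

definition t_prime :: "'k::field set \<Rightarrow> 'k set \<Rightarrow> bool" where
  "t_prime R P \<longleftrightarrow> prime_ideal R P \<and> t_ideal R P"

definition t_maximal :: "'k::field set \<Rightarrow> 'k set \<Rightarrow> bool" where
  "t_maximal R M \<longleftrightarrow> t_ideal R M \<and> M \<noteq> R \<and>
     (\<forall>J. t_ideal R J \<and> J \<noteq> R \<and> M \<subseteq> J \<longrightarrow> J = M)"

definition localization :: "'k::field set \<Rightarrow> 'k set \<Rightarrow> 'k set" where
  "localization R P = {a / s | a s. a \<in> R \<and> s \<in> R \<and> s \<notin> P}"

text \<open>A subring V of K with quotient field K is a valuation domain iff
  for every nonzero x in K, x or x^-1 lies in V.\<close>
definition valuation_domain :: "'k::field set \<Rightarrow> bool" where
  "valuation_domain V \<longleftrightarrow> (\<forall>x. x \<noteq> 0 \<longrightarrow> x \<in> V \<or> inverse x \<in> V)"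

definition PvMD :: "'k::field set \<Rightarrow> bool" where
  "PvMD R \<longleftrightarrow> (\<forall>M. t_maximal R M \<longrightarrow> valuation_domain (localization R M))"

definition strongly_discrete_PvMD :: "'k::field set \<Rightarrow> bool" where
  "strongly_discrete_PvMD R \<longleftrightarrow> PvMD R \<and>
     (\<forall>P. t_prime R P \<longrightarrow> t_op R (mprod R P P) \<noteq> P)"

definition acc_radical_t :: "'k::field set \<Rightarrow> bool" where
  "acc_radical_t R \<longleftrightarrow> (\<forall>f :: nat \<Rightarrow> 'k set.
     (\<forall>n. t_ideal R (f n) \<and> radical_ideal R (f n)) \<and> (\<forall>n. f n \<subseteq> f (Suc n))
       \<longrightarrow> (\<exists>N. \<forall>n\<ge>N. f n = f N))"

definition generalized_Krull :: "'k::field set \<Rightarrow> bool" where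
  "generalized_Krull R \<longleftrightarrow> strongly_discrete_PvMD R \<and> acc_radical_t R"

definition pairwise_incomparable :: "'k set set \<Rightarrow> bool" where
  "pairwise_incomparable S \<longleftrightarrow> (\<forall>P\<in>S. \<forall>Q\<in>S. P \<subseteq> Q \<longrightarrow> P = Q)"

text \<open>Intersection over the empty family is K (= UNIV).\<close>
definition t_sharp_sharp :: "'k::field set \<Rightarrow> bool" where
  "t_sharp_sharp R \<longleftrightarrow> (\<forall>P1 P2.
     (\<forall>P\<in>P1. t_prime R P) \<and> (\<forall>P\<in>P2. t_prime R P) \<and>
     pairwise_incomparable P1 \<and> pairwise_incomparable P2 \<and> P1 \<noteq> P2
       \<longrightarrow> \<Inter>(localization R ` P1) \<noteq> \<Inter>(localization R ` P2))"

definition tRTP :: "'k::field set \<Rightarrow> bool" where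
  "tRTP R \<longleftrightarrow> (\<forall>I. is_ideal R I \<and> I \<noteq> {0} \<longrightarrow>
     t_op R (mprod R I (colon R I)) = R \<or> radical_ideal R (t_op R (mprod R I (colon R I))))"

end

theory Submission
  imports Defs
begin

text \<open>
  Fix a strongly discrete P\<open>v\<close>MD. Each of the conditions on \<open>R\<close> is shown to be equivalent
  to each of three local conditions holding for all \<open>t\<close>-primes \<open>P\<close>:
  \<^item> some \<open>x\<close> outside \<open>R\<^sub>P\<close> lies in \<open>R\<^sub>N\<close> for every \<open>t\<close>-maximal \<open>N\<close> not containing \<open>P\<close>;
  \<^item> some finite \<open>G \<subseteq> P\<close> is contained only in those \<open>t\<close>-maximal ideals that contain \<open>P\<close>
    (for \<open>x\<close> as before, the conductor \<open>(R : R + xR)\<close> is the \<open>t\<close>-closure of a finite set);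
  \<^item> some finite \<open>G \<subseteq> P\<close> is contained only in those radical \<open>t\<close>-ideals that contain \<open>P\<close>
    (add to \<open>G\<close> a generator \<open>a\<close> of \<open>P R\<^sub>P\<close>, which exists by strong discreteness).

  The last one is the Cohen-type criterion for the chain condition on radical \<open>t\<close>-ideals.
  The \<open>t##\<close>-property yields the first one by comparing \<open>\<N>\<close> with \<open>\<N> \<union> {P}\<close>, where \<open>\<N>\<close> is the set
  of \<open>t\<close>-maximal ideals not containing \<open>P\<close>; the trace property yields it when applied to
  \<open>a\<^sup>2 R\<^sub>P \<inter> R\<close>. Conversely, if a trace ideal \<open>J\<close> contained \<open>x\<^sup>n\<close> but not \<open>x\<close>, localizing at a
  \<open>t\<close>-maximal ideal above \<open>(J : x)\<close> gives a \<open>t\<close>-prime \<open>Q\<close> minimal over \<open>(J : x)\<close>; a finite \<open>G\<close> for \<open>Q\<close>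
  provides \<open>h \<in> (R : J)\<close> inverse to a generator of \<open>Q R\<^sub>Q\<close> up to units, and \<open>h\<^sup>k J \<subseteq> J\<close> for all \<open>k\<close>
  forces \<open>x \<in> J R\<^sub>Q\<close>, a contradiction.
\<close>

section \<open>Submodules of the quotient field, spans and colons\<close>

locale qf_domain =
  fixes R :: "'k::field set"
  assumes dom: "domain_with_qf R" and proper: "R \<noteq> UNIV"
begin

lemma zero_in: "0 \<in> R" and one_in: "1 \<in> R"
  and add_in: "a \<in> R \<Longrightarrow> b \<in> R \<Longrightarrow> a + b \<in> R"
  and mult_in: "a \<in> R \<Longrightarrow> b \<in> R \<Longrightarrow> a * b \<in> R"
  using dom unfolding domain_with_qf_def by blast+

lemma power_in: "a \<in> R \<Longrightarrow> a ^ n \<in> R"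
  by (induction n) (auto intro: one_in mult_in)

lemma denominator: obtains b where "b \<in> R" "b \<noteq> 0" "b * x \<in> R"
proof -
  obtain a b where "a \<in> R" "b \<in> R" "b \<noteq> 0" "x = a / b"
    using dom unfolding domain_with_qf_def by blast
  then show thesis using that[of b] by simp
qed

lemma submod_R: "submod R R"
  unfolding submod_def using zero_in add_in mult_in by blast

lemma submod_colon: "submod R N \<Longrightarrow> submod R (colon N A)"
  unfolding submod_def colon_def by (auto simp: distrib_right mult.assoc)

lemma submod_scale_preimage: "submod R N \<Longrightarrow> submod R {z. h * z \<in> N}"
  unfolding submod_def by (auto simp: distrib_left mult.left_commute)

lemma submod_sum: "finite F \<Longrightarrow> submod R N \<Longrightarrow> (\<And>x. x \<in> F \<Longrightarrow> g x \<in> N) \<Longrightarrow> sum g F \<in> N"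
  by (induction F rule: finite_induct) (auto simp: submod_def)

lemma rspan_least: "submod R N \<Longrightarrow> S \<subseteq> N \<Longrightarrow> rspan R S \<subseteq> N"
  unfolding rspan_def
  by (auto intro!: submod_sum) (auto simp: submod_def)

lemma rspan_superset: "S \<subseteq> rspan R S"
proof
  fix x assume "x \<in> S"
  then show "x \<in> rspan R S"
    unfolding rspan_def using one_in
    by (intro CollectI exI[of _ "{x}"] exI[of _ "\<lambda>_. 1"]) auto
qed

lemma zero_in_rspan: "0 \<in> rspan R S"
  unfolding rspan_def by (intro CollectI exI[of _ "{}"]) auto

lemma submod_rspan: "submod R (rspan R S)"
  unfolding submod_def
proof (intro conjI ballI)
  show "0 \<in> rspan R S" by (rule zero_in_rspan)
next
  fix a b assume "a \<in> rspan R S" "b \<in> rspan R S"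
  then obtain F c G d where *: "finite F" "F \<subseteq> S" "\<forall>x\<in>F. c x \<in> R" "a = (\<Sum>x\<in>F. c x * x)"
    "finite G" "G \<subseteq> S" "\<forall>x\<in>G. d x \<in> R" "b = (\<Sum>x\<in>G. d x * x)"
    unfolding rspan_def by auto
  \<comment> \<open>Extending both coefficient families by zero puts the two combinations over the
    common index set \<open>F \<union> G\<close>.\<close>
  let ?c = "\<lambda>x. if x \<in> F then c x else 0" and ?d = "\<lambda>x. if x \<in> G then d x else 0"
  have "a = (\<Sum>x\<in>F \<union> G. ?c x * x)" "b = (\<Sum>x\<in>F \<union> G. ?d x * x)"
    unfolding * by (intro sum.mono_neutral_cong_left; use * in auto)+
  then have "a + b = (\<Sum>x\<in>F \<union> G. (?c x + ?d x) * x)"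
    by (simp only: sum.distrib[symmetric] distrib_right)
  moreover have "\<forall>x\<in>F \<union> G. ?c x + ?d x \<in> R"
    using * zero_in add_in by auto
  ultimately show "a + b \<in> rspan R S"
    unfolding rspan_def using *
    by (intro CollectI exI[of _ "F \<union> G"] exI[of _ "\<lambda>x. ?c x + ?d x"]) auto
next
  fix r a assume "r \<in> R" "a \<in> rspan R S"
  then obtain F c where *: "finite F" "F \<subseteq> S" "\<forall>x\<in>F. c x \<in> R" "a = (\<Sum>x\<in>F. c x * x)"
    unfolding rspan_def by auto
  then have "r * a = (\<Sum>x\<in>F. (r * c x) * x)"
    by (simp add: sum_distrib_left mult.assoc)
  then show "r * a \<in> rspan R S"
    unfolding rspan_def using * \<open>r \<in> R\<close> mult_in
    by (intro CollectI exI[of _ F] exI[of _ "\<lambda>x. r * c x"]) auto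
qed

text \<open>The elements that a fixed \<open>h\<close> multiplies into \<open>N\<close> form a
  submodule, so testing \<open>h\<close> on generators suffices.\<close>

lemma colon_rspan: "submod R N \<Longrightarrow> colon N (rspan R F) = colon N F"
proof
  show "colon N (rspan R F) \<subseteq> colon N F"
    using rspan_superset unfolding colon_def by blast
  assume N: "submod R N"
  show "colon N F \<subseteq> colon N (rspan R F)"
  proof
    fix h assume "h \<in> colon N F"
    then have "rspan R F \<subseteq> {z. h * z \<in> N}"
      using N by (intro rspan_least submod_scale_preimage) (auto simp: colon_def)
    then show "h \<in> colon N (rspan R F)" unfolding colon_def by auto
  qed
qed

section \<open>The v- and t-operations on sets of generators\<close>

lemma v_opD: "y \<in> v_op R F \<Longrightarrow> h \<in> colon R F \<Longrightarrow> y * h \<in> R"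
  unfolding v_op_def colon_def[of R "colon R F"] by simp

lemma v_op_rspan: "v_op R (rspan R F) = v_op R F"
  unfolding v_op_def by (simp add: colon_rspan submod_R)

lemma rspan_nonzero_iff: "rspan R F \<noteq> {0} \<longleftrightarrow> \<not> F \<subseteq> {0}"
proof -
  have "submod R {0}" unfolding submod_def by auto
  then show ?thesis using rspan_least[of "{0}" F] rspan_superset[of F] zero_in_rspan[of F] by auto
qed

text \<open>Since \<open>v_op\<close> depends only on generators, finitely generated submodules can
  be replaced throughout by finite sets with a nonzero element.\<close>

lemma in_t_op_iff:
  "y \<in> t_op R I \<longleftrightarrow> (\<exists>F. finite F \<and> F \<subseteq> I \<and> \<not> F \<subseteq> {0} \<and> y \<in> v_op R F)"
proof -
  have "y \<in> t_op R I \<longleftrightarrow> (\<exists>F. finite F \<and> F \<subseteq> I \<and> rspan R F \<noteq> {0} \<and> y \<in> v_op R (rspan R F))"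
    unfolding t_op_def by blast
  then show ?thesis unfolding rspan_nonzero_iff v_op_rspan .
qed

lemma v_op_subset_t_op: "finite F \<Longrightarrow> F \<subseteq> I \<Longrightarrow> \<not> F \<subseteq> {0} \<Longrightarrow> v_op R F \<subseteq> t_op R I"
  using in_t_op_iff[of _ I] by auto

lemma in_t_opE:
  assumes "y \<in> t_op R I"
  obtains F where "finite F" "F \<subseteq> I" "\<not> F \<subseteq> {0}" "y \<in> v_op R F"
  using assms unfolding in_t_op_iff by auto

lemma t_op_least:
  assumes "\<And>F. finite F \<Longrightarrow> F \<subseteq> I \<Longrightarrow> v_op R F \<subseteq> N"
  shows "t_op R I \<subseteq> N"
proof
  fix y assume "y \<in> t_op R I"
  then obtain F where F: "finite F" "F \<subseteq> I" "y \<in> v_op R F" by (rule in_t_opE)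
  show "y \<in> N" by (rule subsetD[OF assms[OF F(1,2)] F(3)])
qed

lemma v_op_mono: "F \<subseteq> G \<Longrightarrow> v_op R F \<subseteq> v_op R G"
  unfolding v_op_def colon_def by auto

lemma v_op_superset: "F \<subseteq> v_op R F"
  unfolding v_op_def colon_def by (auto simp: mult.commute)

lemma v_op_idem: "v_op R (v_op R F) = v_op R F"
proof
  have "colon R F \<subseteq> colon R (v_op R F)"
    unfolding v_op_def colon_def by (auto simp: mult.commute)
  then show "v_op R (v_op R F) \<subseteq> v_op R F"
    unfolding v_op_def[of R "v_op R F"] unfolding v_op_def[of R F] by (auto simp: colon_def)
qed (rule v_op_superset)

lemma v_op_subset_R: "F \<subseteq> R \<Longrightarrow> v_op R F \<subseteq> R"
proof
  fix y assume "F \<subseteq> R" and y: "y \<in> v_op R F"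
  then have "1 \<in> colon R F" by (auto simp: colon_def)
  then have "y * 1 \<in> R" by (rule v_opD[OF y])
  then show "y \<in> R" by simp
qed

lemma submod_v_op: "submod R (v_op R F)"
  unfolding v_op_def by (intro submod_colon submod_R)

lemma v_op_scale: "y \<in> v_op R F \<Longrightarrow> x * y \<in> v_op R ((*) x ` F)"
proof -
  assume y: "y \<in> v_op R F"
  have "x * y * b \<in> R" if "b \<in> colon R ((*) x ` F)" for b
  proof -
    have "b * x \<in> colon R F" using that unfolding colon_def by (auto simp: mult.assoc)
    then have "y * (b * x) \<in> R" by (rule v_opD[OF y])
    then show ?thesis by (simp add: ac_simps)
  qed
  then show ?thesis unfolding v_op_def by (auto simp: colon_def)
qed

text \<open>Here \<open>proper\<close> enters: the colon is the whole field, and a nonzero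
  \<open>y\<close> has a multiple outside \<open>R\<close>. Closure under \<open>v_op\<close> can
  thus be required of all finite subsets of an ideal, zero ones included.\<close>

lemma v_op_zero: "F \<subseteq> {0} \<Longrightarrow> v_op R F = {0}"
proof -
  assume F: "F \<subseteq> {0}"
  obtain z where z: "z \<notin> R" using proper by auto
  have 1: "colon R F = UNIV" using F zero_in unfolding colon_def by auto
  have "y = 0" if "\<forall>b. y * b \<in> R" for y
  proof (rule ccontr)
    assume "y \<noteq> 0"
    then have "y * (z / y) = z" by simp
    then show False using that z by metis
  qed
  then show ?thesis
    unfolding v_op_def 1 unfolding colon_def using zero_in by auto
qed

lemma t_op_superset: "\<not> A \<subseteq> {0} \<Longrightarrow> A \<subseteq> t_op R A"
proof
  fix x assume "\<not> A \<subseteq> {0}" "x \<in> A"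
  then obtain a where a: "a \<in> A" "a \<noteq> 0" by auto
  \<comment> \<open>As \<open>x\<close> may be 0, a nonzero \<open>a\<close> is added to the
    witness.\<close>
  then show "x \<in> t_op R A"
    unfolding in_t_op_iff using \<open>x \<in> A\<close> v_op_superset[of "{a,x}"]
    by (intro exI[of _ "{a,x}"]) auto
qed

lemma t_op_mono: "A \<subseteq> B \<Longrightarrow> t_op R A \<subseteq> t_op R B"
  unfolding t_op_def by blast

lemma t_op_finite_subset:
  assumes "\<not> A \<subseteq> {0}" "finite F" "F \<subseteq> t_op R A"
  shows "\<exists>G. finite G \<and> G \<subseteq> A \<and> \<not> G \<subseteq> {0} \<and> F \<subseteq> v_op R G"
  using assms(2,3)
proof (induction F rule: finite_induct)
  case empty
  obtain a where "a \<in> A" "a \<noteq> 0" using assms(1) by auto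
  then show ?case by (intro exI[of _ "{a}"]) auto
next
  case (insert x F)
  then obtain G where G: "finite G" "G \<subseteq> A" "\<not> G \<subseteq> {0}" "F \<subseteq> v_op R G" by auto
  obtain H where H: "finite H" "H \<subseteq> A" "x \<in> v_op R H"
    using insert.prems in_t_op_iff[of x A] by auto
  show ?case
    using G H v_op_mono[of G "G \<union> H"] v_op_mono[of H "G \<union> H"]
    by (intro exI[of _ "G \<union> H"]) auto
qed

section \<open>Constructions of t-ideals\<close>

lemma is_idealD:
  assumes "is_ideal R I"
  shows "I \<subseteq> R" "0 \<in> I" "a \<in> I \<Longrightarrow> b \<in> I \<Longrightarrow> a + b \<in> I"
    "r \<in> R \<Longrightarrow> a \<in> I \<Longrightarrow> r * a \<in> I" "r \<in> R \<Longrightarrow> a \<in> I \<Longrightarrow> a * r \<in> I"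
  using assms unfolding is_ideal_def submod_def by (auto simp: mult.commute)

lemma t_idealD:
  assumes "t_ideal R I"
  shows "is_ideal R I" "\<exists>a\<in>I. a \<noteq> 0" "finite F \<Longrightarrow> F \<subseteq> I \<Longrightarrow> v_op R F \<subseteq> I"
proof -
  show 1: "is_ideal R I" using assms unfolding t_ideal_def by auto
  show "\<exists>a\<in>I. a \<noteq> 0" using assms is_idealD(2)[OF 1] unfolding t_ideal_def by auto
  assume F: "finite F" "F \<subseteq> I"
  show "v_op R F \<subseteq> I"
  proof (cases "F \<subseteq> {0}")
    case True
    then show ?thesis using v_op_zero is_idealD(2)[OF 1] by auto
  next
    case False
    then have "v_op R F \<subseteq> t_op R I" using F by (intro v_op_subset_t_op)
    then show ?thesis using assms unfolding t_ideal_def by auto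
  qed
qed

lemma t_idealI:
  assumes "is_ideal R I" "a \<in> I" "a \<noteq> 0" "\<And>F. finite F \<Longrightarrow> F \<subseteq> I \<Longrightarrow> v_op R F \<subseteq> I"
  shows "t_ideal R I"
proof -
  have "t_op R I \<subseteq> I" using assms(4) by (rule t_op_least)
  moreover have "I \<subseteq> t_op R I" using assms(2,3) by (intro t_op_superset) auto
  ultimately show ?thesis using assms(1-3) unfolding t_ideal_def by auto
qed

text \<open>Finitely many elements of \<open>t_op R A\<close> lie in one \<open>v_op R G\<close>
  with \<open>G \<subseteq> A\<close> finite, and \<open>v_op\<close> is idempotent. The ideal
  axioms then follow from closure under \<open>v_op\<close> of sets with at most two
  elements.\<close>

lemma t_ideal_t_op:
  assumes "A \<subseteq> R" "\<not> A \<subseteq> {0}"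
  shows "t_ideal R (t_op R A)"
proof -
  obtain a where a: "a \<in> A" "a \<noteq> 0" using assms by auto
  have sub: "t_op R A \<subseteq> R"
    using assms(1) by (intro t_op_least v_op_subset_R) auto
  have fin: "v_op R F \<subseteq> t_op R A" if F: "finite F" "F \<subseteq> t_op R A" for F
  proof -
    obtain G where G: "finite G" "G \<subseteq> A" "\<not> G \<subseteq> {0}" "F \<subseteq> v_op R G"
      using t_op_finite_subset[OF assms(2) F] by blast
    have "v_op R F \<subseteq> v_op R G" using v_op_mono[OF G(4)] unfolding v_op_idem .
    then show ?thesis using v_op_subset_t_op[OF G(1-3)] by auto
  qed
  have "submod R (t_op R A)"
    unfolding submod_def
  proof (intro conjI ballI)
    show "0 \<in> t_op R A"
      using fin[of "{}"] submod_v_op unfolding submod_def by auto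
    fix x y assume xy: "x \<in> t_op R A" "y \<in> t_op R A"
    then show "x + y \<in> t_op R A"
      using fin[of "{x,y}"] v_op_superset[of "{x,y}"] submod_v_op[of "{x,y}"]
      unfolding submod_def by auto
  next
    fix r x assume xy: "r \<in> R" "x \<in> t_op R A"
    then show "r * x \<in> t_op R A"
      using fin[of "{x}"] v_op_superset[of "{x}"] submod_v_op[of "{x}"]
      unfolding submod_def by auto
  qed
  then show ?thesis
    using sub a t_op_superset[OF assms(2)]
    by (intro t_idealI[of _ a] fin) (auto simp: is_ideal_def)
qed

lemma is_ideal_colon: "submod R N \<Longrightarrow> is_ideal R {r \<in> R. r * x \<in> N}"
  unfolding is_ideal_def submod_def
  using zero_in add_in mult_in by (auto simp: distrib_right mult.assoc)

lemma t_ideal_colon: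
  assumes "t_ideal R L" "x \<in> R"
  shows "t_ideal R {r \<in> R. r * x \<in> L}"
proof -
  obtain a where a: "a \<in> L" "a \<noteq> 0" using t_idealD assms by blast
  note L = t_idealD(1)[OF assms(1)]
  show ?thesis
  proof (rule t_idealI[of _ a])
    show "is_ideal R {r \<in> R. r * x \<in> L}"
      using L by (intro is_ideal_colon) (simp add: is_ideal_def)
    show "a \<in> {r \<in> R. r * x \<in> L}"
      using a is_idealD[OF L] assms by auto
    fix F assume F: "finite F" "F \<subseteq> {r \<in> R. r * x \<in> L}"
    have "v_op R ((*) x ` F) \<subseteq> L"
      using F by (intro t_idealD(3)[OF assms(1)]) (auto simp: mult.commute)
    then show "v_op R F \<subseteq> {r \<in> R. r * x \<in> L}"
      using v_op_scale[of _ F x] v_op_subset_R[of F] F by (auto simp: mult.commute)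
  qed (rule a)
qed

text \<open>This is the conductor (R : R + xR), a proper ideal exactly when \<open>x\<close> is
  outside \<open>R\<close>. The scaling argument for colons applies with \<open>R\<close> in place
  of \<open>L\<close>.\<close>

lemma t_ideal_denominators: "t_ideal R {r \<in> R. r * x \<in> R}"
proof -
  obtain b where b: "b \<in> R" "b \<noteq> 0" "b * x \<in> R" by (rule denominator)
  show ?thesis
  proof (rule t_idealI[of _ b])
    show "is_ideal R {r \<in> R. r * x \<in> R}" by (intro is_ideal_colon submod_R)
    fix F assume F: "finite F" "F \<subseteq> {r \<in> R. r * x \<in> R}"
    have "v_op R ((*) x ` F) \<subseteq> R"
      using F by (intro v_op_subset_R) (auto simp: mult.commute)
    then show "v_op R F \<subseteq> {r \<in> R. r * x \<in> R}"
      using v_op_scale[of _ F x] v_op_subset_R[of F] F by (auto simp: mult.commute)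
  qed (use b in auto)
qed

lemma t_ideal_Inter:
  assumes "\<L> \<noteq> {}" "\<And>L. L \<in> \<L> \<Longrightarrow> t_ideal R L" "a \<in> \<Inter>\<L>" "a \<noteq> 0"
  shows "t_ideal R (\<Inter>\<L>)"
proof (rule t_idealI[of _ a])
  note I = is_idealD[OF t_idealD(1)[OF assms(2)]]
  obtain L where "L \<in> \<L>" using assms(1) by auto
  then have "\<Inter>\<L> \<subseteq> R" using I(1) by fast
  then show "is_ideal R (\<Inter>\<L>)"
    unfolding is_ideal_def submod_def by (auto intro: I)
  fix F assume F: "finite F" "F \<subseteq> \<Inter>\<L>"
  then show "v_op R F \<subseteq> \<Inter>\<L>"
    by (intro Inter_greatest t_idealD(3)[OF assms(2)]) auto
qed (use assms(3,4) in auto)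

lemma chain_finite_subset:
  assumes "subset.chain A \<C>" "\<C> \<noteq> {}" "finite F" "F \<subseteq> \<Union>\<C>"
  shows "\<exists>C\<in>\<C>. F \<subseteq> C"
  using assms finite_subset_Union_chain[of F \<C> A] by metis

text \<open>Sums and \<open>v_op\<close> involve finitely many elements at a time, and these already
  lie in one member of the chain.\<close>

lemma t_ideal_Union_chain:
  assumes chain: "subset.chain A \<C>" and ne: "\<C> \<noteq> {}" and t: "\<And>C. C \<in> \<C> \<Longrightarrow> t_ideal R C"
  shows "t_ideal R (\<Union>\<C>)"
proof -
  note I = is_idealD[OF t_idealD(1)[OF t]]
  obtain C a where C: "C \<in> \<C>" "a \<in> C" "a \<noteq> 0" using ne t_idealD(2)[OF t] by blast
  show ?thesis
  proof (rule t_idealI[of _ a])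
    have add: "x + y \<in> \<Union>\<C>" if xy: "x \<in> \<Union>\<C>" "y \<in> \<Union>\<C>" for x y
    proof -
      obtain D where "D \<in> \<C>" "{x, y} \<subseteq> D"
        using chain_finite_subset[OF chain ne, of "{x,y}"] xy by auto
      then show ?thesis using I(3)[of D x y] by auto
    qed
    have "\<Union>\<C> \<subseteq> R" using I(1) by (rule Union_least)
    then show "is_ideal R (\<Union>\<C>)"
      unfolding is_ideal_def submod_def
    proof (intro conjI ballI)
      show "0 \<in> \<Union>\<C>" using I(2)[OF C(1)] C(1) by auto
      fix r x assume "r \<in> R" "x \<in> \<Union>\<C>"
      then show "r * x \<in> \<Union>\<C>" using I(4) by (meson UnionE UnionI)
    qed (use add in auto)
    fix F assume F: "finite F" "F \<subseteq> \<Union>\<C>"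
    then obtain D where "D \<in> \<C>" "F \<subseteq> D"
      using chain_finite_subset[OF chain ne F] by blast
    then show "v_op R F \<subseteq> \<Union>\<C>"
      using t_idealD(3)[OF t F(1), of D] by auto
  qed (use C in auto)
qed

section \<open>t-maximal ideals and t-primes\<close>

lemma ideal_eq_R_iff: "is_ideal R I \<Longrightarrow> I = R \<longleftrightarrow> 1 \<in> I"
proof
  assume I: "is_ideal R I" and 1: "1 \<in> I"
  have "r \<in> I" if "r \<in> R" for r using is_idealD(4)[OF I that 1] by simp
  then show "I = R" using is_idealD(1)[OF I] by blast
qed (use one_in in auto)

lemma t_maximal_above:
  assumes "t_ideal R I" "1 \<notin> I"
  obtains M where "t_maximal R M" "I \<subseteq> M"
proof -
  let ?A = "{J. t_ideal R J \<and> 1 \<notin> J \<and> I \<subseteq> J}"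
  have "\<exists>M\<in>?A. \<forall>X\<in>?A. M \<subseteq> X \<longrightarrow> X = M"
  proof (rule subset_Zorn_nonempty)
    show "?A \<noteq> {}" using assms by auto
    fix \<C> assume C: "\<C> \<noteq> {}" "subset.chain ?A \<C>"
    then have sub: "\<C> \<subseteq> ?A" by (simp add: subset_chain_def)
    then have "t_ideal R (\<Union>\<C>)" using C by (intro t_ideal_Union_chain[of ?A]) auto
    then show "\<Union>\<C> \<in> ?A" using sub C by blast
  qed
  then obtain M where "M \<in> ?A" and max: "\<forall>X\<in>?A. M \<subseteq> X \<longrightarrow> X = M" by (rule bexE)
  then have M: "t_ideal R M" "1 \<notin> M" "I \<subseteq> M" by auto
  have "t_maximal R M"
    unfolding t_maximal_def
  proof (intro conjI allI impI)
    show "M \<noteq> R" using M(2) one_in by auto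
    fix J assume J: "t_ideal R J \<and> J \<noteq> R \<and> M \<subseteq> J"
    then have "1 \<notin> J" using ideal_eq_R_iff[OF t_idealD(1)] by auto
    then show "J = M" using J M(3) max by auto
  qed (rule M(1))
  then show thesis using that M by blast
qed

lemma t_maximalD:
  assumes "t_maximal R M"
  shows "t_ideal R M" "is_ideal R M" "1 \<notin> M" "t_ideal R J \<Longrightarrow> 1 \<notin> J \<Longrightarrow> M \<subseteq> J \<Longrightarrow> J = M"
proof -
  show "t_ideal R M" using assms unfolding t_maximal_def by auto
  then show I: "is_ideal R M" by (rule t_idealD)
  show "1 \<notin> M" using assms ideal_eq_R_iff[OF I] unfolding t_maximal_def by auto
  show "J = M" if "t_ideal R J" "1 \<notin> J" "M \<subseteq> J"
    using that assms one_in unfolding t_maximal_def by auto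
qed

lemma prime_idealD:
  assumes "prime_ideal R P"
  shows "is_ideal R P" "1 \<notin> P" "a \<in> R \<Longrightarrow> b \<in> R \<Longrightarrow> a * b \<in> P \<Longrightarrow> a \<in> P \<or> b \<in> P"
  using assms ideal_eq_R_iff[of P] unfolding prime_ideal_def by auto

text \<open>For \<open>b\<close> outside \<open>M\<close>, the ideal (M : b) is a proper t-ideal
  containing \<open>M\<close>, hence equal to \<open>M\<close> by maximality.\<close>

lemma t_maximal_t_prime: "t_maximal R M \<Longrightarrow> t_prime R M"
proof -
  assume M: "t_maximal R M"
  note I = is_idealD[OF t_maximalD(2)[OF M]]
  have "a \<in> M" if ab: "a \<in> R" "b \<in> R" "a * b \<in> M" "b \<notin> M" for a b
  proof -
    have "{r \<in> R. r * b \<in> M} = M"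
    proof (rule t_maximalD(4)[OF M])
      show "t_ideal R {r \<in> R. r * b \<in> M}"
        using t_maximalD(1)[OF M] ab by (intro t_ideal_colon)
    qed (use ab I in auto)
    then show ?thesis using ab by auto
  qed
  then show ?thesis
    unfolding t_prime_def prime_ideal_def using t_maximalD(1-3)[OF M] one_in by auto
qed

lemma t_primeD:
  assumes "t_prime R P"
  shows "prime_ideal R P" "t_ideal R P" "is_ideal R P" "1 \<notin> P"
  using assms prime_idealD[of P] unfolding t_prime_def by auto

lemma t_maximal_prime: "t_maximal R M \<Longrightarrow> prime_ideal R M"
  by (rule t_primeD(1)[OF t_maximal_t_prime])

text \<open>A local-to-global device: to show \<open>x \<in> L\<close>, it suffices to find, for
  each such \<open>M\<close>, some \<open>u\<close> outside \<open>M\<close> with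
  \<open>u * x \<in> L\<close>.\<close>

lemma t_maximal_containing_colon:
  assumes "t_ideal R L" "x \<in> R" "x \<notin> L"
  obtains M where "t_maximal R M" "L \<subseteq> M" "\<And>u. u \<in> R \<Longrightarrow> u * x \<in> L \<Longrightarrow> u \<in> M"
proof -
  obtain M where M: "t_maximal R M" "{r \<in> R. r * x \<in> L} \<subseteq> M"
    using t_ideal_colon[OF assms(1,2)] assms(3) t_maximal_above[of "{r \<in> R. r * x \<in> L}"] by auto
  moreover have "L \<subseteq> {r \<in> R. r * x \<in> L}"
    using is_idealD[OF t_idealD(1)[OF assms(1)]] assms(2) by auto
  ultimately show thesis using that[of M] by auto
qed

section \<open>Localizations at primes and at t-maximal ideals\<close>

lemma in_localization_iff:
  assumes "prime_ideal R P"
  shows "x \<in> localization R P \<longleftrightarrow> (\<exists>s\<in>R. s \<notin> P \<and> s * x \<in> R)"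
proof
  have z: "0 \<in> P" using is_idealD(2) prime_idealD(1) assms by auto
  show "\<exists>s\<in>R. s \<notin> P \<and> s * x \<in> R" if "x \<in> localization R P"
    using that z unfolding localization_def by force
  assume "\<exists>s\<in>R. s \<notin> P \<and> s * x \<in> R"
  then obtain s where s: "s \<in> R" "s \<notin> P" "s * x \<in> R" by blast
  then have "x = (s * x) / s" using z by auto
  then show "x \<in> localization R P" unfolding localization_def using s by blast
qed

lemma prime_mult_notin:
  "prime_ideal R P \<Longrightarrow> a \<in> R \<Longrightarrow> b \<in> R \<Longrightarrow> a \<notin> P \<Longrightarrow> b \<notin> P \<Longrightarrow> a * b \<notin> P"
  using prime_idealD(3)[of P a b] by auto

lemma prime_power_notin: "prime_ideal R P \<Longrightarrow> a \<in> R \<Longrightarrow> a \<notin> P \<Longrightarrow> a ^ n \<notin> P"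
  by (induction n) (auto simp: prime_idealD(2) prime_mult_notin power_in)

lemma prime_radical: "prime_ideal R P \<Longrightarrow> radical_ideal R P"
  unfolding radical_ideal_def using prime_idealD(1)[of P] prime_power_notin[of P] by auto

lemma localization_mult:
  assumes P: "prime_ideal R P" and "x \<in> localization R P" "y \<in> localization R P"
  shows "x * y \<in> localization R P"
proof -
  obtain s t where st: "s \<in> R" "s \<notin> P" "s * x \<in> R" "t \<in> R" "t \<notin> P" "t * y \<in> R"
    using assms(2,3) unfolding in_localization_iff[OF P] by auto
  then have "(s * t) * (x * y) = (s * x) * (t * y)" by (simp add: ac_simps)
  then have "(s * t) * (x * y) \<in> R" using st mult_in by metis
  then show ?thesis
    using st(1,2,4,5) prime_mult_notin[OF P] mult_in unfolding in_localization_iff[OF P] by blast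
qed

lemma common_denominator:
  assumes P: "prime_ideal R P" and "finite F" "F \<subseteq> localization R P"
  shows "\<exists>s\<in>R. s \<notin> P \<and> (\<forall>f\<in>F. s * f \<in> R)"
  using assms(2,3)
proof (induction F rule: finite_induct)
  case empty
  then show ?case using one_in prime_idealD(2)[OF P] by auto
next
  case (insert x F)
  then obtain s t where s: "s \<in> R" "s \<notin> P" "\<forall>f\<in>F. s * f \<in> R" and t: "t \<in> R" "t \<notin> P" "t * x \<in> R"
    using in_localization_iff[OF P, of x] by auto
  have "(s * t) * x \<in> R" using mult_in[OF s(1) t(3)] by (simp add: ac_simps)
  moreover have "(s * t) * f \<in> R" if "f \<in> F" for f
    using mult_in[OF t(1), of "s * f"] s that by (simp add: ac_simps)
  ultimately show ?case
    using s t prime_mult_notin[OF P] mult_in by (intro bexI[of _ "s * t"]) auto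
qed

text \<open>A common denominator \<open>s\<close> of the quotients \<open>f / a\<close> puts
  \<open>s / a\<close> into \<open>colon R F\<close>, so \<open>y * (s / a)\<close> lies in
  \<open>R\<close>.\<close>

lemma v_op_principal_localization:
  assumes P: "prime_ideal R P" and a: "a \<noteq> 0" and "finite F"
    and F: "\<And>f. f \<in> F \<Longrightarrow> f / a \<in> localization R P" and y: "y \<in> v_op R F"
  shows "y / a \<in> localization R P"
proof -
  obtain s where s: "s \<in> R" "s \<notin> P" "\<forall>f\<in>(\<lambda>f. f / a) ` F. s * f \<in> R"
    using common_denominator[OF P, of "(\<lambda>f. f / a) ` F"] F \<open>finite F\<close> by auto
  then have "s / a \<in> colon R F" unfolding colon_def by auto
  then have "y * (s / a) \<in> R" by (rule v_opD[OF y])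
  then show ?thesis
    unfolding in_localization_iff[OF P] using s by (intro bexI[of _ s]) (auto simp: mult.commute)
qed

text \<open>Otherwise the conductor of \<open>x\<close> is a proper t-ideal, and at a t-maximal
  ideal above it \<open>x\<close> has no admissible denominator.\<close>

lemma locally_integral_imp_integral:
  assumes "\<And>N. t_maximal R N \<Longrightarrow> x \<in> localization R N"
  shows "x \<in> R"
proof (rule ccontr)
  assume "x \<notin> R"
  then obtain M where M: "t_maximal R M" "{r \<in> R. r * x \<in> R} \<subseteq> M"
    using t_maximal_above[OF t_ideal_denominators[of x]] by auto
  then show False
    using assms[OF M(1)] in_localization_iff[OF t_maximal_prime[OF M(1)]] by blast
qed

text \<open>Comparability of \<open>a\<close> and \<open>b\<close> in the valuation domain R_P, with
  denominators cleared.\<close>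

lemma valuation_total:
  assumes P: "prime_ideal R P" "valuation_domain (localization R P)" and ne: "a \<noteq> 0 \<or> b \<noteq> 0"
  shows "(\<exists>u\<in>R. \<exists>c\<in>R. u \<notin> P \<and> u * a = c * b) \<or> (\<exists>u\<in>R. \<exists>c\<in>R. u \<notin> P \<and> u * b = c * a)"
proof (cases "a = 0 \<or> b = 0")
  case True
  then show ?thesis using one_in zero_in prime_idealD(2)[OF P(1)] by (metis mult_zero_left mult_zero_right)
next
  case False
  then have "a / b \<in> localization R P \<or> b / a \<in> localization R P"
    using P(2) unfolding valuation_domain_def by (metis divide_eq_0_iff inverse_divide)
  then obtain s where s: "s \<in> R" "s \<notin> P" "s * (a / b) \<in> R \<or> s * (b / a) \<in> R"
    unfolding in_localization_iff[OF P(1)] by auto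
  have "s * a = (s * (a / b)) * b" "s * b = (s * (b / a)) * a" using False by auto
  then show ?thesis using s by metis
qed

lemma localization_antimono: "P \<subseteq> M \<Longrightarrow> localization R M \<subseteq> localization R P"
  unfolding localization_def by blast

text \<open>Some nonzero \<open>g \<in> G\<close> has least value at \<open>P\<close>. If
  \<open>s\<close> outside \<open>P\<close> clears the denominators of all \<open>f / g\<close>,
  then \<open>h = s / g\<close> works because \<open>h * g = s\<close>. This is the invertibility of
  finitely generated ideals over R_P, phrased in \<open>R\<close>.\<close>

lemma colon_unit_pairing:
  assumes P: "prime_ideal R P" "valuation_domain (localization R P)"
    and G: "finite G" "\<not> G \<subseteq> {0}"
  obtains g h where "g \<in> G" "g \<noteq> 0" "h \<in> colon R G" "h * g \<in> R" "h * g \<notin> P"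
proof -
  have "\<exists>g\<in>F. g \<noteq> 0 \<and> (\<forall>f\<in>F. f / g \<in> localization R P)" if "finite F" "\<not> F \<subseteq> {0}" for F
    using that
  proof (induction F rule: finite_induct)
    case empty
    then show ?case by simp
  next
    case (insert x F)
    have loc1: "1 \<in> localization R P" and loc0: "0 \<in> localization R P"
      unfolding in_localization_iff[OF P(1)] using one_in zero_in prime_idealD(2)[OF P(1)] by auto
    show ?case
    proof (cases "F \<subseteq> {0}")
      case True
      then have "x \<noteq> 0" using insert.prems by auto
      then show ?thesis using True loc0 loc1 by (intro bexI[of _ x]) auto
    next
      case False
      then obtain g where g: "g \<in> F" "g \<noteq> 0" "\<forall>f\<in>F. f / g \<in> localization R P"
        using insert.IH by auto
      show ?thesis
      proof (cases "x / g \<in> localization R P")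
        case True
        then show ?thesis using g by (intro bexI[of _ g]) auto
      next
        case f: False
        then have x: "x \<noteq> 0" using loc0 by auto
        then have gx: "g / x \<in> localization R P"
          using P(2) f g unfolding valuation_domain_def by (metis divide_eq_0_iff inverse_divide)
        have "f / x \<in> localization R P" if "f \<in> F" for f
          using localization_mult[OF P(1) _ gx, of "f / g"] g that x by simp
        then show ?thesis using x loc1 by (intro bexI[of _ x]) auto
      qed
    qed
  qed
  from this[OF G] obtain g where g: "g \<in> G" "g \<noteq> 0" "\<forall>f\<in>G. f / g \<in> localization R P" by blast
  obtain s where s: "s \<in> R" "s \<notin> P" "\<forall>f\<in>(\<lambda>f. f / g) ` G. s * f \<in> R"
    using common_denominator[OF P(1), of "(\<lambda>f. f / g) ` G"] g(3) G(1) by auto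
  show thesis
    using that[of g "s / g"] g s unfolding colon_def by auto
qed

lemma mprod_mem: "a \<in> A \<Longrightarrow> b \<in> B \<Longrightarrow> a * b \<in> mprod R A B"
  unfolding mprod_def by (rule subsetD[OF rspan_superset]) auto

lemma mprod_least:
  "submod R N \<Longrightarrow> (\<And>a b. a \<in> A \<Longrightarrow> b \<in> B \<Longrightarrow> a * b \<in> N) \<Longrightarrow> mprod R A B \<subseteq> N"
  unfolding mprod_def by (rule rspan_least) auto

lemma submod_mprod: "submod R (mprod R A B)"
  unfolding mprod_def by (rule submod_rspan)

lemma is_ideal_submod: "is_ideal R I \<Longrightarrow> submod R I"
  unfolding is_ideal_def by simp

section \<open>Radical t-ideals and the radical t-closure of a set\<close>

definition radical_t_ideal :: "'k set \<Rightarrow> bool" where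
  "radical_t_ideal L \<longleftrightarrow> t_ideal R L \<and> radical_ideal R L"

lemma radical_t_idealD:
  assumes "radical_t_ideal L"
  shows "t_ideal R L" "is_ideal R L" "x \<in> R \<Longrightarrow> x ^ n \<in> L \<Longrightarrow> x \<in> L"
  using assms unfolding radical_t_ideal_def radical_ideal_def by auto

lemma radical_t_idealI:
  assumes "t_ideal R L" "\<And>x n. x \<in> R \<Longrightarrow> x ^ n \<in> L \<Longrightarrow> x \<in> L"
  shows "radical_t_ideal L"
  using assms t_idealD(1)[OF assms(1)] unfolding radical_t_ideal_def radical_ideal_def by auto

lemma radical_t_ideal_R: "radical_t_ideal R"
proof (rule radical_t_idealI)
  have "is_ideal R R" unfolding is_ideal_def using submod_R by simp
  then show "t_ideal R R"
    using one_in v_op_subset_R by (intro t_idealI[of R 1]) auto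
qed

text \<open>For n > 0 the power \<open>(y * x) ^ n\<close> is a multiple of
  \<open>y ^ n * x\<close>; for n = 0 the assumption already says \<open>x \<in> L\<close>.\<close>

lemma radical_t_ideal_colon:
  assumes L: "radical_t_ideal L" and x: "x \<in> R"
  shows "radical_t_ideal {r \<in> R. r * x \<in> L}"
proof (rule radical_t_idealI)
  note I = is_idealD[OF radical_t_idealD(2)[OF L]]
  show "t_ideal R {r \<in> R. r * x \<in> L}" using radical_t_idealD(1)[OF L] x by (rule t_ideal_colon)
  fix y n assume y: "y \<in> R" "y ^ n \<in> {r \<in> R. r * x \<in> L}"
  have "y * x \<in> L"
  proof (cases n)
    case 0
    then show ?thesis using y I(4) by simp
  next
    case (Suc m)
    have "(y * x) ^ n = x ^ m * (y ^ n * x)" by (simp add: Suc power_mult_distrib ac_simps)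
    then have "(y * x) ^ n \<in> L" using I(4)[OF power_in[OF x]] y by auto
    then show ?thesis using radical_t_idealD(3)[OF L mult_in[OF y(1) x]] by blast
  qed
  then show "y \<in> {r \<in> R. r * x \<in> L}" using y by auto
qed

lemma radical_t_ideal_Union_chain:
  assumes "subset.chain A \<C>" "\<C> \<noteq> {}" and r: "\<And>C. C \<in> \<C> \<Longrightarrow> radical_t_ideal C"
  shows "radical_t_ideal (\<Union>\<C>)"
proof (rule radical_t_idealI)
  show "t_ideal R (\<Union>\<C>)" using assms radical_t_idealD(1) by (intro t_ideal_Union_chain) auto
  fix x n assume x: "x \<in> R" "x ^ n \<in> \<Union>\<C>"
  then obtain C where C: "C \<in> \<C>" "x ^ n \<in> C" by auto
  then show "x \<in> \<Union>\<C>" using radical_t_idealD(3)[OF r[OF C(1)] x(1) C(2)] by auto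
qed

definition radical_t_closure :: "'k set \<Rightarrow> 'k set" where
  "radical_t_closure G = \<Inter>{L. radical_t_ideal L \<and> G \<subseteq> L}"

lemma radical_t_closure:
  assumes "G \<subseteq> R" "a \<in> G" "a \<noteq> 0"
  shows "radical_t_ideal (radical_t_closure G)"
proof (rule radical_t_idealI)
  show "t_ideal R (radical_t_closure G)"
    unfolding radical_t_closure_def
  proof (rule t_ideal_Inter[of _ a])
    show "{L. radical_t_ideal L \<and> G \<subseteq> L} \<noteq> {}" using radical_t_ideal_R assms by auto
  qed (use assms radical_t_idealD(1) in auto)
  fix x n assume "x \<in> R" "x ^ n \<in> radical_t_closure G"
  then show "x \<in> radical_t_closure G"
    unfolding radical_t_closure_def using radical_t_idealD(3)[of _ x n] by auto
qed

lemma radical_t_closure_superset: "G \<subseteq> radical_t_closure G"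
  unfolding radical_t_closure_def by auto

lemma radical_t_closure_least: "radical_t_ideal L \<Longrightarrow> G \<subseteq> L \<Longrightarrow> radical_t_closure G \<subseteq> L"
  unfolding radical_t_closure_def by auto

lemma radical_t_closure_mono: "G \<subseteq> H \<Longrightarrow> radical_t_closure G \<subseteq> radical_t_closure H"
  unfolding radical_t_closure_def by auto

section \<open>Radical finiteness and the Cohen-type criterion for the chain condition\<close>

definition radically_finite :: "'k set \<Rightarrow> bool" where
  "radically_finite I \<longleftrightarrow> (\<exists>G. finite G \<and> G \<subseteq> I \<and> (\<forall>L. radical_t_ideal L \<and> G \<subseteq> L \<longrightarrow> I \<subseteq> L))"

lemma radically_finiteE:
  assumes "radically_finite I"
  obtains G where "finite G" "G \<subseteq> I" "\<forall>L. radical_t_ideal L \<and> G \<subseteq> L \<longrightarrow> I \<subseteq> L"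
  using assms unfolding radically_finite_def by (elim exE conjE)

text \<open>If no finite subset works, each finite \<open>G \<subseteq> I\<close> misses some
  \<open>p G\<close> of \<open>I\<close> in its radical t-closure. Adjoining these elements one
  after another gives a strictly increasing chain of closures.\<close>

lemma acc_imp_radically_finite:
  assumes acc: "acc_radical_t R" and I: "t_ideal R I"
  shows "radically_finite I"
proof (rule ccontr)
  assume nf: "\<not> radically_finite I"
  have IR: "I \<subseteq> R" using is_idealD(1)[OF t_idealD(1)[OF I]] .
  have "\<exists>p\<in>I. p \<notin> radical_t_closure G" if G: "finite G" "G \<subseteq> I" for G
  proof -
    have "\<not> (\<forall>L. radical_t_ideal L \<and> G \<subseteq> L \<longrightarrow> I \<subseteq> L)"
      using nf G unfolding radically_finite_def not_ex by (drule_tac spec[of _ G]) simp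
    then obtain L where "radical_t_ideal L" "G \<subseteq> L" "\<not> I \<subseteq> L" by auto
    then show ?thesis using radical_t_closure_least[of L G] by auto
  qed
  then have "\<forall>G. \<exists>p. finite G \<and> G \<subseteq> I \<longrightarrow> p \<in> I \<and> p \<notin> radical_t_closure G" by auto
  then obtain p where p: "\<forall>G. finite G \<and> G \<subseteq> I \<longrightarrow> p G \<in> I \<and> p G \<notin> radical_t_closure G"
    by (rule choice[THEN exE])
  obtain a where a: "a \<in> I" "a \<noteq> 0" using t_idealD(2)[OF I] by auto
  \<comment> \<open>Starting from a nonzero \<open>a\<close> makes every closure in the chain a
    t-ideal.\<close>
  define G where "G = rec_nat {a} (\<lambda>_ H. insert (p H) H)"
  have G_0: "G 0 = {a}" and G_Suc: "G (Suc n) = insert (p (G n)) (G n)" for n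
    unfolding G_def by simp_all
  have G: "finite (G n) \<and> G n \<subseteq> I \<and> a \<in> G n" for n
    by (induction n) (use a p in \<open>auto simp: G_0 G_Suc\<close>)
  define f where "f n = radical_t_closure (G n)" for n
  have "radical_t_ideal (f n)" for n
    unfolding f_def using G[of n] IR a by (intro radical_t_closure[of _ a]) auto
  moreover have "f n \<subseteq> f (Suc n)" for n
    unfolding f_def by (rule radical_t_closure_mono) (auto simp: G_Suc)
  ultimately obtain N where N: "\<forall>n\<ge>N. f n = f N"
    using acc unfolding acc_radical_t_def radical_t_ideal_def by meson
  have "p (G N) \<in> f (Suc N)"
    unfolding f_def using radical_t_closure_superset[of "G (Suc N)"] by (auto simp: G_Suc)
  then have "p (G N) \<in> f N" using N[rule_format, of "Suc N"] by simp
  then show False using p G[of N] unfolding f_def by auto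
qed

text \<open>Cohen's argument: if \<open>a * b \<in> P\<close> with both factors outside
  \<open>P\<close>, the closures of P + a and P + b are radically finite by maximality, and the
  products of their finite generating sets \<open>A\<close> and \<open>B\<close> witness that
  \<open>P\<close> is radically finite as well.\<close>

lemma maximal_not_radically_finite_prime:
  assumes P: "radical_t_ideal P" "\<not> radically_finite P"
    and max: "\<And>X. radical_t_ideal X \<Longrightarrow> \<not> radically_finite X \<Longrightarrow> P \<subseteq> X \<Longrightarrow> X = P"
  shows "t_prime R P"
proof -
  note I = is_idealD[OF radical_t_idealD(2)[OF P(1)]]
  obtain z where z: "z \<in> P" "z \<noteq> 0" using t_idealD(2)[OF radical_t_idealD(1)[OF P(1)]] by auto
  have "P \<noteq> R"
  proof
    assume "P = R"
    moreover have "R \<subseteq> L" if "radical_t_ideal L" "{1} \<subseteq> L" for L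
      using ideal_eq_R_iff[OF radical_t_idealD(2)[OF that(1)]] that(2) by auto
    ultimately have "radically_finite P"
      unfolding radically_finite_def using one_in by (intro exI[of _ "{1}"]) auto
    then show False using P(2) by simp
  qed
  moreover have "a \<in> P \<or> b \<in> P" if ab: "a \<in> R" "b \<in> R" "a * b \<in> P" for a b
  proof (rule ccontr)
    assume "\<not> (a \<in> P \<or> b \<in> P)"
    define C where "C x = radical_t_closure (insert x P)" for x
    have C: "radical_t_ideal (C x)" "P \<subseteq> C x" "x \<in> C x" if "x \<in> R" for x
      unfolding C_def using radical_t_closure[of "insert x P" z] radical_t_closure_superset[of "insert x P"]
        z that I(1) by auto
    have fin: "radically_finite (C x)" if "x \<in> R" "x \<notin> P" for x
      using max[of "C x"] C[OF that(1)] that(2) by auto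
    have "radically_finite (C a)" "radically_finite (C b)"
      using fin ab \<open>\<not> (a \<in> P \<or> b \<in> P)\<close> by auto
    then obtain A B where
      A: "finite A" "A \<subseteq> C a" "\<forall>L. radical_t_ideal L \<and> A \<subseteq> L \<longrightarrow> C a \<subseteq> L" and
      B: "finite B" "B \<subseteq> C b" "\<forall>L. radical_t_ideal L \<and> B \<subseteq> L \<longrightarrow> C b \<subseteq> L"
      by (elim radically_finiteE)
    have CR: "C x \<subseteq> R" if "x \<in> R" for x
      using is_idealD(1)[OF radical_t_idealD(2)[OF C(1)[OF that]]] .
    \<comment> \<open>Two colon ideals are used in turn: (P : b) contains \<open>P\<close> and
      \<open>a\<close>, hence \<open>C a\<close>; then (P : g) contains \<open>P\<close> and
      \<open>b\<close>, hence \<open>C b\<close>.\<close>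
    have prod: "g * h \<in> P" if gh: "g \<in> C a" "h \<in> C b" for g h
    proof -
      have g: "g \<in> R" using gh CR[OF ab(1)] by auto
      have "C a \<subseteq> {r \<in> R. r * b \<in> P}"
        unfolding C_def using ab I by (intro radical_t_closure_least radical_t_ideal_colon P) auto
      then have "b * g \<in> P" using gh by (auto simp: mult.commute)
      then have "C b \<subseteq> {r \<in> R. r * g \<in> P}"
        unfolding C_def using ab I g by (intro radical_t_closure_least radical_t_ideal_colon P) auto
      then show ?thesis using gh by (auto simp: mult.commute)
    qed
    have "radically_finite P"
      unfolding radically_finite_def
    proof (intro exI[of _ "(\<lambda>(g, h). g * h) ` (A \<times> B)"] conjI allI impI)
      show "finite ((\<lambda>(g, h). g * h) ` (A \<times> B))" using A(1) B(1) by auto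
      show "(\<lambda>(g, h). g * h) ` (A \<times> B) \<subseteq> P" using A(2) B(2) prod by auto
      fix L assume L: "radical_t_ideal L \<and> (\<lambda>(g, h). g * h) ` (A \<times> B) \<subseteq> L"
      then have L': "radical_t_ideal L" and AB: "\<And>g h. g \<in> A \<Longrightarrow> h \<in> B \<Longrightarrow> g * h \<in> L" by auto
      have AR: "A \<subseteq> R" and BR: "B \<subseteq> R" using A(2) B(2) CR ab by blast+
      show "P \<subseteq> L"
      proof
        fix q assume q: "q \<in> P"
        then have qR: "q \<in> R" using I(1) by auto
        \<comment> \<open>An element \<open>q\<close> of \<open>P\<close> lies in both closures.
          Through \<open>C a\<close> it gives \<open>h * q \<in> L\<close> for all
          \<open>h \<in> B\<close>, then through \<open>C b\<close> it gives
          \<open>q ^ 2 \<in> L\<close>.\<close>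
        have "h * q \<in> L" if h: "h \<in> B" for h
        proof -
          have "h \<in> R" using h BR by auto
          then have "C a \<subseteq> {r \<in> R. r * h \<in> L}"
            using AB h AR by (intro A(3)[rule_format] conjI radical_t_ideal_colon L') auto
          then show ?thesis using q C(2)[OF ab(1)] by (auto simp: mult.commute)
        qed
        then have "C b \<subseteq> {r \<in> R. r * q \<in> L}"
          using BR qR by (intro B(3)[rule_format] conjI radical_t_ideal_colon L') auto
        then have "q ^ 2 \<in> L" using q C(2)[OF ab(2)] by (auto simp: power2_eq_square)
        then show "q \<in> L" using radical_t_idealD(3)[OF L' qR] by blast
      qed
    qed
    then show False using P(2) by simp
  qed
  ultimately show ?thesis
    unfolding t_prime_def prime_ideal_def using radical_t_idealD(1,2)[OF P(1)] by auto
qed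

text \<open>The union of a chain that never stabilizes is not radically finite. Zorn's lemma then
  provides a maximal radical t-ideal of this kind, which is a t-prime by Cohen's argument.\<close>

lemma radically_finite_imp_acc:
  assumes fin: "\<And>P. t_prime R P \<Longrightarrow> radically_finite P"
  shows "acc_radical_t R"
proof (rule ccontr)
  assume "\<not> acc_radical_t R"
  then obtain f :: "nat \<Rightarrow> 'k set" where f: "\<forall>n. t_ideal R (f n) \<and> radical_ideal R (f n)"
    "\<forall>n. f n \<subseteq> f (Suc n)" "\<not> (\<exists>N. \<forall>n\<ge>N. f n = f N)"
    unfolding acc_radical_t_def by auto
  have mono: "f m \<subseteq> f n" if "m \<le> n" for m n using lift_Suc_mono_le[of f] f(2) that by auto
  have chain: "subset.chain UNIV (range f)"
    unfolding subset_chain_def using mono by (metis UNIV_I imageE nle_le subsetI)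
  have f_rad: "radical_t_ideal (f n)" for n using f(1) unfolding radical_t_ideal_def by auto
  define \<S> where "\<S> = {I. radical_t_ideal I \<and> \<not> radically_finite I}"
  have "\<Union>(range f) \<in> \<S>"
  proof -
    have "radical_t_ideal (\<Union>(range f))"
      using chain f_rad by (intro radical_t_ideal_Union_chain) auto
    moreover have "\<not> radically_finite (\<Union>(range f))"
    proof
      assume "radically_finite (\<Union>(range f))"
      then obtain G where G: "finite G" "G \<subseteq> \<Union>(range f)"
        "\<forall>L. radical_t_ideal L \<and> G \<subseteq> L \<longrightarrow> \<Union>(range f) \<subseteq> L"
        by (rule radically_finiteE)
      obtain N where "G \<subseteq> f N" using chain_finite_subset[OF chain _ G(1,2)] by auto
      then have "\<Union>(range f) \<subseteq> f N" using G(3) f_rad by auto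
      then have "\<forall>n\<ge>N. f n = f N" using mono by (meson UN_subset_iff UNIV_I subset_antisym)
      then show False by (rule notE[OF f(3) exI])
    qed
    ultimately show ?thesis unfolding \<S>_def by auto
  qed
  then have ne: "\<S> \<noteq> {}" by auto
  have "\<exists>M\<in>\<S>. \<forall>X\<in>\<S>. M \<subseteq> X \<longrightarrow> X = M"
  proof (rule subset_Zorn_nonempty[OF ne])
    fix \<C> assume C: "\<C> \<noteq> {}" "subset.chain \<S> \<C>"
    then have sub: "\<C> \<subseteq> \<S>" by (simp add: subset_chain_def)
    then have rad: "radical_t_ideal C" if "C \<in> \<C>" for C using that unfolding \<S>_def by auto
    \<comment> \<open>A finite witness for the union lies in one member \<open>D\<close>, which then
      equals the union and would itself be radically finite.\<close>
    have "\<not> radically_finite (\<Union>\<C>)"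
    proof
      assume rf: "radically_finite (\<Union>\<C>)"
      then obtain G where G: "finite G" "G \<subseteq> \<Union>\<C>"
        "\<forall>L. radical_t_ideal L \<and> G \<subseteq> L \<longrightarrow> \<Union>\<C> \<subseteq> L"
        by (rule radically_finiteE)
      obtain D where D: "D \<in> \<C>" "G \<subseteq> D" using chain_finite_subset[OF C(2,1) G(1,2)] by auto
      then have "\<Union>\<C> = D" using G(3) rad[OF D(1)] D by blast
      then show False using rf D sub unfolding \<S>_def by auto
    qed
    then show "\<Union>\<C> \<in> \<S>"
      unfolding \<S>_def using radical_t_ideal_Union_chain[OF C(2,1) rad] by auto
  qed
  then obtain P where "P \<in> \<S>" "\<forall>X\<in>\<S>. P \<subseteq> X \<longrightarrow> X = P" by (rule bexE)
  then have "t_prime R P"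
    unfolding \<S>_def by (intro maximal_not_radically_finite_prime) auto
  then show False using fin[of P] \<open>P \<in> \<S>\<close> unfolding \<S>_def by auto
qed

text \<open>In a valuation domain R_M one has P R_P = P R_M: elements outside \<open>P\<close>
  divide elements of \<open>P\<close>, with quotient again in \<open>P\<close>. If instead
  \<open>p\<close> divided \<open>s\<close> locally at \<open>M\<close>, then \<open>s\<close> would
  be in \<open>P\<close>.\<close>

lemma prime_divide_off:
  assumes P: "prime_ideal R P" and M: "prime_ideal R M" "valuation_domain (localization R M)"
    and "P \<subseteq> M" and p: "p \<in> P" and s: "s \<in> R" "s \<notin> P"
  obtains u d where "u \<in> R" "u \<notin> M" "d \<in> P" "u * p = d * s"
proof -
  note I = is_idealD[OF prime_idealD(1)[OF P]]
  have "p \<in> R" using p I(1) by auto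
  have "s \<noteq> 0" using s I(2) by auto
  then consider u c where "u \<in> R" "c \<in> R" "u \<notin> M" "u * p = c * s"
    | u c where "u \<in> R" "c \<in> R" "u \<notin> M" "u * s = c * p"
    using valuation_total[OF M, of p s] by auto
  then show thesis
  proof cases
    case 1
    then have "c * s \<in> P" using I(4)[OF 1(1) p] by simp
    then have "c \<in> P" using prime_idealD(3)[OF P 1(2) s(1)] s(2) by auto
    then show thesis using that 1 by auto
  next
    case 2
    then have "u * s \<in> P" using I(4)[OF 2(2) p] by simp
    then have "u \<in> P" using prime_idealD(3)[OF P 2(1) s(1)] s(2) by auto
    then show thesis using 2 \<open>P \<subseteq> M\<close> by auto
  qed
qed

end

section \<open>Valuation rings and local generators at t-primes\<close>

locale strongly_discrete_domain = qf_domain R for R :: "'k::field set" +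
  assumes sd: "strongly_discrete_PvMD R"
begin

lemma t_maximal_valuation: "t_maximal R M \<Longrightarrow> valuation_domain (localization R M)"
  using sd unfolding strongly_discrete_PvMD_def PvMD_def by auto

text \<open>R_P is an overring of the valuation domain R_M for a t-maximal \<open>M\<close> above
  \<open>P\<close>.\<close>

lemma t_prime_valuation:
  assumes "t_prime R P"
  shows "valuation_domain (localization R P)"
proof -
  obtain M where M: "t_maximal R M" "P \<subseteq> M"
    using t_maximal_above[OF t_primeD(2,4)[OF assms]] by auto
  then show ?thesis
    using t_maximal_valuation[OF M(1)] localization_antimono[OF M(2)]
    unfolding valuation_domain_def by auto
qed

text \<open>If P R_P is not principal, every \<open>a \<in> P\<close> is locally a product of two
  elements of \<open>P\<close>. Hence \<open>P\<close> lies in the t-closure of its square, against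
  strong discreteness.\<close>

lemma t_prime_locally_principal:
  assumes P: "t_prime R P"
  shows "\<exists>a\<in>P. a \<noteq> 0 \<and> (\<forall>p\<in>P. \<exists>s\<in>R. \<exists>c\<in>R. s \<notin> P \<and> s * p = c * a)"
proof (rule ccontr)
  assume "\<not> ?thesis"
  then have np: "\<exists>p\<in>P. \<forall>s\<in>R. \<forall>c\<in>R. s \<notin> P \<longrightarrow> s * p \<noteq> c * a" if "a \<in> P" "a \<noteq> 0" for a
    using that by blast
  note Pp = t_primeD(1)[OF P]
  note I = is_idealD[OF t_primeD(3)[OF P]]
  let ?T = "t_op R (mprod R P P)"
  have sub: "mprod R P P \<subseteq> P"
    using I by (intro mprod_least is_ideal_submod t_primeD(3)[OF P]) auto
  obtain z where z: "z \<in> P" "z \<noteq> 0" using t_idealD(2)[OF t_primeD(2)[OF P]] by auto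
  have nz: "\<not> mprod R P P \<subseteq> {0}" using mprod_mem[OF z(1) z(1)] z(2) by auto
  have T: "t_ideal R ?T" using sub I(1) nz by (intro t_ideal_t_op) auto
  have TP: "?T \<subseteq> P"
    using t_op_mono[OF sub] t_primeD(2)[OF P] unfolding t_ideal_def by auto
  have PPT: "p * q \<in> ?T" if "p \<in> P" "q \<in> P" for p q
    using t_op_superset[OF nz] mprod_mem[OF that] by auto
  have "P \<subseteq> ?T"
  proof (rule subsetI, rule ccontr)
    fix a assume a: "a \<in> P" "a \<notin> ?T"
    have "a \<noteq> 0" using a is_idealD(2)[OF t_idealD(1)[OF T]] by auto
    have aR: "a \<in> R" using a I(1) by auto
    obtain M where M: "t_maximal R M" "?T \<subseteq> M" "\<And>u. u \<in> R \<Longrightarrow> u * a \<in> ?T \<Longrightarrow> u \<in> M"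
      using t_maximal_containing_colon[OF T aR a(2)] by blast
    have PM: "P \<subseteq> M" using M(3) PPT a(1) I(1) by auto
    obtain p where p: "p \<in> P" "\<forall>s\<in>R. \<forall>c\<in>R. s \<notin> P \<longrightarrow> s * p \<noteq> c * a"
      using np[OF a(1) \<open>a \<noteq> 0\<close>] by auto
    obtain s c where s: "s \<in> R" "c \<in> R" "s \<notin> P" "s * a = c * p"
      using valuation_total[OF Pp t_prime_valuation[OF P], of p a] p(2) \<open>a \<noteq> 0\<close> by auto
    \<comment> \<open>Were \<open>c\<close> outside \<open>P\<close>, the relation
      \<open>s * a = c * p\<close> would make \<open>p\<close> a multiple of \<open>a\<close> in
      R_P. Dividing \<open>c\<close> by \<open>s\<close> now turns the relation into
      \<open>u * a = d * p\<close> with both factors in \<open>P\<close>.\<close>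
    have "c \<in> P" using p(2) s by metis
    then obtain u d where u: "u \<in> R" "u \<notin> M" "d \<in> P" "u * c = d * s"
      using prime_divide_off[OF Pp t_maximal_prime[OF M(1)] t_maximal_valuation[OF M(1)] PM _ s(1,3)]
      by blast
    have "s * (u * a) = u * c * p" using s(4) by (simp add: ac_simps)
    also have "\<dots> = s * (d * p)" unfolding u(4) by (simp add: ac_simps)
    finally have "u * a = d * p" using s(3) I(2) by auto
    then have "u * a \<in> ?T" using PPT[OF u(3) p(1)] by simp
    then show False using M(3) u by auto
  qed
  then have "?T = P" using TP by auto
  then show False using sd P unfolding strongly_discrete_PvMD_def by auto
qed

section \<open>Separation, finite support and radical finiteness of t-primes\<close>

definition finitely_t_supported :: "'k set \<Rightarrow> bool" where
  "finitely_t_supported P \<longleftrightarrow>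
     (\<exists>G. finite G \<and> G \<subseteq> P \<and> (\<forall>M. t_maximal R M \<and> G \<subseteq> M \<longrightarrow> P \<subseteq> M))"

definition t_separated :: "'k set \<Rightarrow> bool" where
  "t_separated P \<longleftrightarrow>
     (\<exists>x. x \<notin> localization R P \<and> (\<forall>N. t_maximal R N \<and> \<not> P \<subseteq> N \<longrightarrow> x \<in> localization R N))"

text \<open>R + xR is locally principal at every t-maximal ideal, hence t-invertible with inverse
  the conductor \<open>J\<close>. Here \<open>S\<close> generates the product of \<open>J\<close>
  and R + xR, and a finite part of \<open>S\<close> already has 1 in its v-closure.\<close>

lemma t_separated_imp_finitely_t_supported:
  assumes P: "t_prime R P" and sep: "t_separated P"
  shows "finitely_t_supported P"
proof -
  obtain x where x: "x \<notin> localization R P"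
    "\<And>N. t_maximal R N \<Longrightarrow> \<not> P \<subseteq> N \<Longrightarrow> x \<in> localization R N"
    using sep unfolding t_separated_def by auto
  note Pp = t_primeD(1)[OF P]
  have x0: "x \<noteq> 0"
  proof
    assume "x = 0"
    then have "x \<in> localization R P"
      unfolding in_localization_iff[OF Pp] using one_in zero_in t_primeD(4)[OF P] by auto
    then show False using x(1) by simp
  qed
  define J where "J = {r \<in> R. r * x \<in> R}"
  define S where "S = J \<union> (\<lambda>b. b * x) ` J"
  have SR: "S \<subseteq> R" unfolding S_def J_def by auto
  have nz: "\<not> S \<subseteq> {0}"
    using t_idealD(2)[OF t_ideal_denominators[of x]] unfolding S_def J_def by auto
  have T: "t_ideal R (t_op R S)" by (rule t_ideal_t_op[OF SR nz])
  have "1 \<in> t_op R S"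
  proof (rule ccontr)
    assume "1 \<notin> t_op R S"
    then obtain M where M: "t_maximal R M" "t_op R S \<subseteq> M"
      using t_maximal_above[OF T] by auto
    have "finite {1, x}" "\<not> {1, x} \<subseteq> {0}" by auto
    then obtain g h where gh: "g \<in> {1, x}" "h \<in> colon R {1, x}" "h * g \<notin> M"
      by (rule colon_unit_pairing[OF t_maximal_prime[OF M(1)] t_maximal_valuation[OF M(1)]])
    then have "h \<in> J" unfolding J_def colon_def by auto
    then have "h * g \<in> S" unfolding S_def using gh(1) by auto
    then show False using gh(3) M(2) t_op_superset[OF nz] by auto
  qed
  then obtain F where F: "finite F" "F \<subseteq> S" "1 \<in> v_op R F" by (rule in_t_opE)
  show ?thesis
    unfolding finitely_t_supported_def
  \<comment> \<open>Each element of \<open>F\<close> is \<open>b\<close> or \<open>b * x\<close>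
    with \<open>b \<in> J\<close>; the witness contains all such \<open>b\<close>, recovered as
    \<open>f\<close> or \<open>f / x\<close>.\<close>
  proof (intro exI[of _ "(F \<union> (\<lambda>f. f / x) ` F) \<inter> J"] conjI allI impI)
    show "finite ((F \<union> (\<lambda>f. f / x) ` F) \<inter> J)" using F(1) by auto
    have "J \<subseteq> P" using x(1) unfolding J_def in_localization_iff[OF Pp] by auto
    then show "(F \<union> (\<lambda>f. f / x) ` F) \<inter> J \<subseteq> P" by auto
    fix M assume M: "t_maximal R M \<and> (F \<union> (\<lambda>f. f / x) ` F) \<inter> J \<subseteq> M"
    then have tM: "t_maximal R M" by simp
    note Mp = t_maximal_prime[OF tM]
    note I = is_idealD[OF t_maximalD(2)[OF tM]]
    show "P \<subseteq> M"
    proof (rule ccontr)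
      assume "\<not> P \<subseteq> M"
      then obtain s where s: "s \<in> R" "s \<notin> M" "s * x \<in> R"
        using x(2)[OF tM] unfolding in_localization_iff[OF Mp] by auto
      have "F \<subseteq> M"
      proof
        fix f assume f: "f \<in> F"
        then have fR: "f \<in> R" using F(2) SR by auto
        consider "f \<in> J" | b where "b \<in> J" "f = b * x" using f F(2) unfolding S_def by auto
        then show "f \<in> M"
        proof cases
          case 1
          then show ?thesis using f M by auto
        next
          case 2
          have "b = f / x" using 2 x0 by simp
          then have "b \<in> M" using f M 2 by auto
          then have "(s * x) * b \<in> M" using I(4)[OF s(3)] by simp
          then have "s * f \<in> M" using 2 by (simp add: ac_simps)
          then show ?thesis using prime_idealD(3)[OF Mp s(1) fR] s(2) by auto
        qed
      qed
      then have "1 \<in> M" using t_idealD(3)[OF t_maximalD(1)[OF tM] F(1)] F(3) by auto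
      then show False using t_maximalD(3)[OF tM] by simp
    qed
  qed
qed

lemma finitely_t_supported_imp_radically_finite:
  assumes P: "t_prime R P" and supp: "finitely_t_supported P"
  shows "radically_finite P"
proof -
  note Pp = t_primeD(1)[OF P]
  note IP = is_idealD[OF t_primeD(3)[OF P]]
  obtain G where G: "finite G" "G \<subseteq> P" "\<And>M. t_maximal R M \<Longrightarrow> G \<subseteq> M \<Longrightarrow> P \<subseteq> M"
    using supp unfolding finitely_t_supported_def by auto
  obtain a where a: "a \<in> P" "\<forall>p\<in>P. \<exists>s\<in>R. \<exists>c\<in>R. s \<notin> P \<and> s * p = c * a"
    using t_prime_locally_principal[OF P] by auto
  show ?thesis
    unfolding radically_finite_def
  proof (intro exI[of _ "insert a G"] conjI allI impI)
    fix L assume L: "radical_t_ideal L \<and> insert a G \<subseteq> L"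
    then have Lr: "radical_t_ideal L" by simp
    note IL = is_idealD[OF radical_t_idealD(2)[OF Lr]]
    show "P \<subseteq> L"
    proof (rule subsetI, rule ccontr)
      fix p assume p: "p \<in> P" "p \<notin> L"
      have pR: "p \<in> R" using p IP(1) by auto
      obtain M where M: "t_maximal R M" "L \<subseteq> M" "\<And>u. u \<in> R \<Longrightarrow> u * p \<in> L \<Longrightarrow> u \<in> M"
        using t_maximal_containing_colon[OF radical_t_idealD(1)[OF Lr] pR p(2)] by blast
      have PM: "P \<subseteq> M" using G(3)[OF M(1)] M(2) L by auto
      obtain s c where s: "s \<in> R" "c \<in> R" "s \<notin> P" "s * p = c * a" using a(2) p(1) by auto
      obtain u d where u: "u \<in> R" "u \<notin> M" "d \<in> P" "u * p = d * s"
        using prime_divide_off[OF Pp t_maximal_prime[OF M(1)] t_maximal_valuation[OF M(1)] PM p(1) s(1,3)]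
        by blast
      \<comment> \<open>Squaring brings the factor \<open>s\<close> next to \<open>p\<close>, so
        that \<open>s * p = c * a\<close> applies and the square becomes a multiple of the local
        generator \<open>a\<close>, which is in \<open>L\<close>.\<close>
      have "(u * p) ^ 2 = (d * s) * (u * p)" by (simp add: power2_eq_square u(4))
      also have "\<dots> = (d * u) * (s * p)" by (simp add: ac_simps)
      also have "\<dots> = (d * u * c) * a" by (simp add: s(4))
      finally have "(u * p) ^ 2 = (d * u * c) * a" .
      moreover have "d * u * c \<in> R" using u s IP(1) by (intro mult_in) auto
      ultimately have "(u * p) ^ 2 \<in> L" using IL(4) L by auto
      then have "u * p \<in> L" using radical_t_idealD(3)[OF Lr mult_in[OF u(1) pR]] by blast
      then show False using M(3) u by auto
    qed
  qed (use G a in auto)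
qed

section \<open>The relation with the t##-property\<close>

text \<open>If no \<open>Q\<close> contains \<open>P\<close>, each misses some
  \<open>f \<in> G\<close>. An \<open>h\<close> in (R : G) pairing to a unit at \<open>P\<close>
  then has denominator \<open>f\<close> at \<open>Q\<close>, so it lies in every R_Q but not in
  R_P.\<close>

lemma radically_finite_contained:
  assumes P: "t_prime R P" "radically_finite P" and Q: "\<And>Q. Q \<in> \<Q> \<Longrightarrow> t_prime R Q"
    and sub: "\<Inter>(localization R ` \<Q>) \<subseteq> localization R P"
  shows "\<exists>Q\<in>\<Q>. P \<subseteq> Q"
proof (rule ccontr)
  assume no: "\<not> (\<exists>Q\<in>\<Q>. P \<subseteq> Q)"
  note Pp = t_primeD(1)[OF P(1)]
  note IP = is_idealD[OF t_primeD(3)[OF P(1)]]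
  obtain G where G: "finite G" "G \<subseteq> P" "\<forall>L. radical_t_ideal L \<and> G \<subseteq> L \<longrightarrow> P \<subseteq> L"
    using P(2) by (rule radically_finiteE)
  obtain z where z: "z \<in> P" "z \<noteq> 0" using t_idealD(2)[OF t_primeD(2)[OF P(1)]] by auto
  have "finite (insert z G)" "\<not> insert z G \<subseteq> {0}" using G(1) z(2) by auto
  then obtain g h where gh: "g \<in> insert z G" "h \<in> colon R (insert z G)" "h * g \<in> R" "h * g \<notin> P"
    by (rule colon_unit_pairing[OF Pp t_prime_valuation[OF P(1)]])
  have "h \<in> localization R Q" if Q': "Q \<in> \<Q>" for Q
  proof -
    have "radical_t_ideal Q"
      using t_primeD(1,2)[OF Q[OF Q']] prime_radical unfolding radical_t_ideal_def by auto
    then obtain f where f: "f \<in> G" "f \<notin> Q" using G(3)[rule_format, of Q] no Q' by auto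
    then have "f * h \<in> R" using gh(2) unfolding colon_def by (auto simp: mult.commute)
    then show ?thesis
      unfolding in_localization_iff[OF t_primeD(1)[OF Q[OF Q']]] using f G(2) IP(1) by auto
  qed
  then have "h \<in> localization R P" using sub by auto
  then obtain s where s: "s \<in> R" "s \<notin> P" "s * h \<in> R" unfolding in_localization_iff[OF Pp] by auto
  have "g \<in> P" using gh(1) z(1) G(2) by auto
  then have "s * (h * g) \<in> P" using IP(4)[OF s(3)] by (simp add: mult.assoc)
  then show False using prime_idealD(3)[OF Pp s(1) gh(3)] s(2) gh(4) by auto
qed

text \<open>Equal intersections give, for \<open>P\<close> in one family, a \<open>Q\<close> above
  it in the other and a \<open>P'\<close> above \<open>Q\<close> in the first. Incomparability
  collapses \<open>P \<subseteq> Q \<subseteq> P'\<close> to equalities.\<close>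

lemma radically_finite_imp_t_sharp_sharp:
  assumes fin: "\<And>P. t_prime R P \<Longrightarrow> radically_finite P"
  shows "t_sharp_sharp R"
proof -
  have *: "P1 \<subseteq> P2"
    if t: "\<forall>P\<in>P1. t_prime R P" "\<forall>P\<in>P2. t_prime R P" and inc: "pairwise_incomparable P1"
      and eq: "\<Inter>(localization R ` P1) = \<Inter>(localization R ` P2)" for P1 P2
  proof
    have cont: "\<exists>Q\<in>B. P \<subseteq> Q"
      if "P \<in> A" "\<forall>P\<in>A. t_prime R P" "\<forall>P\<in>B. t_prime R P"
        "\<Inter>(localization R ` A) = \<Inter>(localization R ` B)" for A B P
      using that fin by (intro radically_finite_contained) auto
    fix P assume P: "P \<in> P1"
    then obtain Q where Q: "Q \<in> P2" "P \<subseteq> Q" using cont[OF P t eq] by auto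
    obtain P' where P': "P' \<in> P1" "Q \<subseteq> P'" using cont[OF Q(1) t(2,1) eq[symmetric]] by auto
    have "P \<subseteq> P'" using Q P' by auto
    then have "P = P'" using inc P P' unfolding pairwise_incomparable_def by auto
    then show "P \<in> P2" using Q P' by auto
  qed
  show ?thesis
    unfolding t_sharp_sharp_def
  proof (intro allI impI notI)
    fix P1 P2
    assume h: "(\<forall>P\<in>P1. t_prime R P) \<and> (\<forall>P\<in>P2. t_prime R P) \<and>
      pairwise_incomparable P1 \<and> pairwise_incomparable P2 \<and> P1 \<noteq> P2"
      and eq: "\<Inter>(localization R ` P1) = \<Inter>(localization R ` P2)"
    have "P1 \<subseteq> P2" "P2 \<subseteq> P1" using *[OF _ _ _ eq] *[OF _ _ _ eq[symmetric]] h by simp_all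
    then show False using h by auto
  qed
qed

lemma t_sharp_sharp_imp_t_separated:
  assumes sharp: "t_sharp_sharp R" and P: "t_prime R P"
  shows "t_separated P"
proof -
  define \<N> where "\<N> = {N. t_maximal R N \<and> \<not> P \<subseteq> N}"
  have inc: "pairwise_incomparable (insert P \<N>)"
    unfolding pairwise_incomparable_def
  proof (intro ballI impI)
    fix A B assume A: "A \<in> insert P \<N>" and B: "B \<in> insert P \<N>" and AB: "A \<subseteq> B"
    show "A = B"
    proof (cases "A = P")
      case True
      then show ?thesis using B AB unfolding \<N>_def by auto
    next
      case False
      then have tA: "t_maximal R A" using A unfolding \<N>_def by auto
      have "t_prime R B" using B P t_maximal_t_prime unfolding \<N>_def by auto
      then show ?thesis using t_maximalD(4)[OF tA t_primeD(2,4) AB] by auto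
    qed
  qed
  then have inc': "pairwise_incomparable \<N>" unfolding pairwise_incomparable_def by auto
  have "\<forall>N\<in>\<N>. t_prime R N" unfolding \<N>_def using t_maximal_t_prime by auto
  moreover have "P \<notin> \<N>" unfolding \<N>_def by auto
  then have "insert P \<N> \<noteq> \<N>" by blast
  ultimately have "\<Inter>(localization R ` insert P \<N>) \<noteq> \<Inter>(localization R ` \<N>)"
    using sharp[unfolded t_sharp_sharp_def, rule_format, of "insert P \<N>" \<N>] inc inc' P by blast
  then obtain x where "x \<in> \<Inter>(localization R ` \<N>)" "x \<notin> localization R P" by auto
  then show ?thesis unfolding t_separated_def \<N>_def by (intro exI[of _ x]) auto
qed

section \<open>Trace ideals and the tRTP-property\<close>

text \<open>For \<open>y\<close> in \<open>v_op R F\<close> and a unit pairing \<open>h * g\<close>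
  at \<open>M\<close>, the product \<open>y * (h * g)\<close> lies in \<open>Q\<close> while
  \<open>h * g\<close> lies outside \<open>M\<close>, hence outside \<open>Q\<close>.\<close>

lemma prime_below_t_maximal:
  assumes Q: "prime_ideal R Q" "z \<in> Q" "z \<noteq> 0" and M: "t_maximal R M" "Q \<subseteq> M"
  shows "t_prime R Q"
proof -
  note I = is_idealD[OF prime_idealD(1)[OF Q(1)]]
  have "t_ideal R Q"
  proof (rule t_idealI[OF prime_idealD(1)[OF Q(1)] Q(2,3)], rule subsetI)
    fix F y assume F: "finite F" "F \<subseteq> Q" and y: "y \<in> v_op R F"
    show "y \<in> Q"
    proof (cases "F \<subseteq> {0}")
      case True
      then show ?thesis using y v_op_zero[OF True] I(2) by auto
    next
      case False
      obtain g h where gh: "g \<in> F" "h \<in> colon R F" "h * g \<in> R" "h * g \<notin> M"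
        using colon_unit_pairing[OF t_maximal_prime[OF M(1)] t_maximal_valuation[OF M(1)] F(1) False]
        by blast
      have "g \<in> Q" using gh(1) F(2) by auto
      then have "(y * h) * g \<in> Q" using I(4)[OF v_opD[OF y gh(2)]] by auto
      then have "y * (h * g) \<in> Q" by (simp add: mult.assoc)
      moreover have "y \<in> R" using y v_op_subset_R[of F] F(2) I(1) by auto
      ultimately show ?thesis using prime_idealD(3)[OF Q(1) _ gh(3)] gh(4) M(2) by auto
    qed
  qed
  then show ?thesis using Q(1) unfolding t_prime_def by simp
qed

text \<open>Such an \<open>h\<close> maps (R : I) into itself, hence also the trace I(R : I);
  scaling finite sets passes this on to the t-closure. The case \<open>h = 0\<close> is separate
  because scaling must preserve nonzero finite sets.\<close>

lemma trace_colon: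
  assumes h: "h \<in> colon R (t_op R (mprod R I (colon R I)))"
    and nz: "\<not> mprod R I (colon R I) \<subseteq> {0}"
    and j: "j \<in> t_op R (mprod R I (colon R I))"
  shows "h * j \<in> t_op R (mprod R I (colon R I))"
proof (cases "h = 0")
  case True
  have "0 \<in> mprod R I (colon R I)" using submod_mprod unfolding submod_def by auto
  then show ?thesis using True t_op_superset[OF nz] by auto
next
  case False
  let ?A = "mprod R I (colon R I)"
  have "?A \<subseteq> {z. h * z \<in> ?A}"
  proof (rule mprod_least[OF submod_scale_preimage[OF submod_mprod]])
    fix i k assume ik: "i \<in> I" "k \<in> colon R I"
    have "h * k \<in> colon R I"
      unfolding colon_def
    proof (intro CollectI ballI)
      fix b assume "b \<in> I"
      then have "b * k \<in> t_op R ?A" using mprod_mem[OF _ ik(2)] t_op_superset[OF nz] by auto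
      then have "h * (b * k) \<in> R" using h by (simp add: colon_def)
      then show "h * k * b \<in> R" by (simp add: ac_simps)
    qed
    then have "i * (h * k) \<in> ?A" by (rule mprod_mem[OF ik(1)])
    then show "i * k \<in> {z. h * z \<in> ?A}" by (simp add: ac_simps)
  qed
  moreover obtain F where F: "finite F" "F \<subseteq> ?A" "\<not> F \<subseteq> {0}" "j \<in> v_op R F"
    using j by (rule in_t_opE)
  ultimately have "(*) h ` F \<subseteq> ?A" "finite ((*) h ` F)" "\<not> (*) h ` F \<subseteq> {0}"
    using False by auto
  then have "v_op R ((*) h ` F) \<subseteq> t_op R ?A" by (intro v_op_subset_t_op)
  then show ?thesis using v_op_scale[OF F(4), of h] by auto
qed

lemma supported_imp_trace_radical:
  assumes supp: "\<And>P. t_prime R P \<Longrightarrow> finitely_t_supported P"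
    and J: "t_ideal R J" and trace: "\<And>h j. h \<in> colon R J \<Longrightarrow> j \<in> J \<Longrightarrow> h * j \<in> J"
  shows "radical_ideal R J"
proof -
  note IJ = is_idealD[OF t_idealD(1)[OF J]]
  have "x \<in> J" if x: "x \<in> R" "x ^ n \<in> J" for x n
  proof (rule ccontr)
    assume xJ: "x \<notin> J"
    have x0: "x \<noteq> 0" using xJ IJ(2) by auto
    obtain M where M: "t_maximal R M" "J \<subseteq> M" "\<And>u. u \<in> R \<Longrightarrow> u * x \<in> J \<Longrightarrow> u \<in> M"
      using t_maximal_containing_colon[OF J x(1) xJ] by blast
    note Mp = t_maximal_prime[OF M(1)]
    note Mv = t_maximal_valuation[OF M(1)]
    \<comment> \<open>the contraction to \<open>R\<close> of the radical of \<open>x\<^sup>-\<^sup>1 J R\<^sub>M\<close>, a prime since \<open>R\<^sub>M\<close> is a valuation domain\<close>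
    define Q where "Q = {r \<in> R. \<exists>k. \<exists>u\<in>R. u \<notin> M \<and> u * r ^ k * x \<in> J}"
    have QI: "r \<in> Q" if "r \<in> R" "u \<in> R" "u \<notin> M" "u * r ^ k * x \<in> J" for r u k
      using that unfolding Q_def by auto
    have Q1: "r \<in> Q" if "r \<in> R" "r * x \<in> J" for r
      using QI[of r 1 1] that one_in prime_idealD(2)[OF Mp] by auto
    have QR: "Q \<subseteq> R" unfolding Q_def by auto
    \<comment> \<open>\<open>Q\<close> contains every element of \<open>R\<close> that is an
      R_M-multiple of one of its members. The ideal and prime axioms are all reduced to this and to
      comparability in R_M.\<close>
    have dom: "z \<in> Q" if z: "z \<in> R" "v \<in> R" "v \<notin> M" "c \<in> R" "q \<in> Q" "v * z = c * q" for z v c q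
    proof -
      obtain k u where u: "u \<in> R" "u \<notin> M" "u * q ^ k * x \<in> J" using z(5) unfolding Q_def by auto
      have "(u * v ^ k) * z ^ k * x = u * (v * z) ^ k * x"
        by (simp add: power_mult_distrib ac_simps)
      also have "\<dots> = c ^ k * (u * q ^ k * x)"
        unfolding z(6) by (simp add: power_mult_distrib ac_simps)
      finally have "(u * v ^ k) * z ^ k * x = c ^ k * (u * q ^ k * x)" .
      then have "(u * v ^ k) * z ^ k * x \<in> J"
        using IJ(4)[OF power_in[OF z(4), of k] u(3)] by (simp only:)
      moreover have "u * v ^ k \<notin> M"
        using u z power_in prime_power_notin[OF Mp] by (intro prime_mult_notin[OF Mp]) auto
      ultimately show ?thesis using u z power_in mult_in by (intro QI[of z "u * v ^ k" k]) auto
    qed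
    have Q0: "0 \<in> Q" using Q1[of 0] zero_in IJ(2) by auto
    have one: "1 \<notin> M" using prime_idealD(2)[OF Mp] .
    have total: "\<exists>u\<in>R. \<exists>c\<in>R. u \<notin> M \<and> (u * a = c * b \<or> u * b = c * a)" for a b
    proof (cases "a = 0 \<and> b = 0")
      case True
      then show ?thesis using one one_in by auto
    next
      case False
      then show ?thesis using valuation_total[OF Mp Mv, of a b] by auto
    qed
    have QM: "Q \<subseteq> M"
    proof (rule subsetI, rule ccontr)
      fix r assume r: "r \<in> Q" "r \<notin> M"
      then obtain k u where u: "u \<in> R" "u \<notin> M" "u * r ^ k * x \<in> J" unfolding Q_def by auto
      have "u * r ^ k \<notin> M"
        using r u QR power_in prime_power_notin[OF Mp] by (intro prime_mult_notin[OF Mp]) auto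
      moreover have "u * r ^ k \<in> R" using r u QR power_in mult_in by auto
      ultimately show False using M(3) u(3) by auto
    qed
    have Qp: "prime_ideal R Q"
      unfolding prime_ideal_def is_ideal_def submod_def
    proof (intro conjI ballI impI)
      show "0 \<in> Q" by (rule Q0)
      show "Q \<noteq> R" using QM one one_in by auto
      fix a b assume ab: "a \<in> Q" "b \<in> Q"
      obtain u c where u: "u \<in> R" "c \<in> R" "u \<notin> M" "u * a = c * b \<or> u * b = c * a"
        using total[of a b] by auto
      have "u * (a + b) = (c + u) * b \<or> u * (a + b) = (c + u) * a"
        using u(4) by (auto simp: algebra_simps)
      moreover have "a + b \<in> R" "c + u \<in> R" using ab QR u add_in by auto
      ultimately show "a + b \<in> Q" using dom[of "a + b" u "c + u"] ab u by auto
    next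
      fix r a assume ra: "r \<in> R" "a \<in> Q"
      then have "r * a \<in> R" using QR mult_in by auto
      then show "r * a \<in> Q" using dom[of "r * a" 1 r a] ra one one_in by auto
    next
      fix a b assume ab: "a \<in> R" "b \<in> R" "a * b \<in> Q"
      have sq: "z \<in> Q" if z: "z \<in> R" "z * z \<in> Q" for z
      proof -
        obtain k u where "u \<in> R" "u \<notin> M" "u * (z * z) ^ k * x \<in> J"
          using z(2) unfolding Q_def by auto
        then show ?thesis
          using z(1) by (intro QI[of z u "2 * k"]) (auto simp: power_mult power2_eq_square)
      qed
      \<comment> \<open>Whichever of \<open>a\<close> and \<open>b\<close> is the multiple of the
        other has its square an R_M-multiple of \<open>a * b\<close>.\<close>
      obtain u c where u: "u \<in> R" "c \<in> R" "u \<notin> M" "u * a = c * b \<or> u * b = c * a"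
        using total[of a b] by auto
      then have "u * (a * a) = c * (a * b) \<or> u * (b * b) = c * (a * b)"
        by (metis mult.assoc mult.commute)
      then have "a * a \<in> Q \<or> b * b \<in> Q"
        using dom[of "a * a" u c "a * b"] dom[of "b * b" u c "a * b"] ab u mult_in by auto
      then show "a \<in> Q \<or> b \<in> Q" using sq ab by auto
    qed (rule QR)
    note IQ = is_idealD[OF prime_idealD(1)[OF Qp]]
    have JQ: "J \<subseteq> Q" using Q1 IJ(1) IJ(5)[OF x(1)] by auto
    obtain z where z: "z \<in> J" "z \<noteq> 0" using t_idealD(2)[OF J] by auto
    have Qt: "t_prime R Q" using z JQ by (intro prime_below_t_maximal[OF Qp _ _ M(1) QM]) auto
    have xQ: "x \<in> Q" using prime_power_notin[OF Qp x(1)] x(2) JQ by auto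
    \<comment> \<open>Locally at \<open>M\<close>, all of \<open>J\<close> lies in xQ: otherwise
      \<open>x\<close> would be an R_M-multiple of an element of \<open>J\<close>, against the
      choice of \<open>M\<close>.\<close>
    have div: "\<exists>u\<in>R. \<exists>c\<in>Q. u \<notin> M \<and> u * j = c * x" if j: "j \<in> J" for j
    proof -
      consider u c where "u \<in> R" "c \<in> R" "u \<notin> M" "u * j = c * x"
        | u c where "u \<in> R" "c \<in> R" "u \<notin> M" "u * x = c * j"
        using valuation_total[OF Mp Mv, of j x] x0 by auto
      then show ?thesis
      proof cases
        case 1
        then have "c * x \<in> J" using IJ(4)[OF 1(1) j] by simp
        then have "c \<in> Q" using Q1 1 by auto
        then show ?thesis using 1 by auto
      next
        case 2
        then have "u * x \<in> J" using IJ(4)[OF 2(2) j] by simp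
        then show ?thesis using M(3) 2 by auto
      qed
    qed
    obtain q where q: "q \<in> Q" "q \<noteq> 0" "\<forall>p\<in>Q. \<exists>s\<in>R. \<exists>c\<in>R. s \<notin> Q \<and> s * p = c * q"
      using t_prime_locally_principal[OF Qt] by auto
    obtain G where G: "finite G" "G \<subseteq> Q" "\<forall>N. t_maximal R N \<and> G \<subseteq> N \<longrightarrow> Q \<subseteq> N"
      using supp[OF Qt] unfolding finitely_t_supported_def by auto
    have "finite (insert q G)" "\<not> insert q G \<subseteq> {0}" using G(1) q(2) by auto
    then obtain g h where gh: "g \<in> insert q G" "h \<in> colon R (insert q G)" "h * g \<in> R" "h * g \<notin> Q"
      by (rule colon_unit_pairing[OF Qp t_prime_valuation[OF Qt]])
    have hG: "h * f \<in> R" if "f \<in> insert q G" for f using gh(2) that unfolding colon_def by auto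
    have hq: "h * q \<in> R" by (rule hG) simp
    \<comment> \<open>The element \<open>g\<close> is an R_Q-multiple of the generator
      \<open>q\<close>, so if \<open>h * q\<close> were in \<open>Q\<close>, then
      \<open>h * g\<close> would be too.\<close>
    have hqQ: "h * q \<notin> Q"
    proof
      assume hq': "h * q \<in> Q"
      have "g \<in> Q" using gh(1) q(1) G(2) by auto
      then obtain s c where s: "s \<in> R" "c \<in> R" "s \<notin> Q" "s * g = c * q" using q(3) by auto
      have "s * (h * g) = h * (s * g)" by (simp add: ac_simps)
      also have "\<dots> = c * (h * q)" unfolding s(4) by (simp add: ac_simps)
      finally have "s * (h * g) \<in> Q" using IQ(4)[OF s(2) hq'] by (simp only:)
      then show False using prime_idealD(3)[OF Qp s(1) gh(3)] s(3) gh(4) by auto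
    qed
    \<comment> \<open>At \<open>N\<close> above \<open>Q\<close>, \<open>j\<close> is an
      R_Q-multiple of \<open>q * x\<close>, so \<open>h * j\<close> is in Q R_Q = Q R_N because
      \<open>x \<in> Q\<close>. At any other \<open>N\<close>, some \<open>f \<in> G\<close> outside
      \<open>N\<close> is a denominator of \<open>h\<close>.\<close>
    have "h * j \<in> R" if j: "j \<in> J" for j
    proof (rule locally_integral_imp_integral)
      fix N assume N: "t_maximal R N"
      note Np = t_maximal_prime[OF N]
      have jR: "j \<in> R" using j IJ(1) by auto
      show "h * j \<in> localization R N"
      proof (cases "Q \<subseteq> N")
        case True
        obtain u c where u: "u \<in> R" "c \<in> Q" "u \<notin> M" "u * j = c * x" using div[OF j] by auto
        obtain s d where s: "s \<in> R" "d \<in> R" "s \<notin> Q" "s * c = d * q" using q(3) u(2) by auto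
        have eq: "(s * u) * (h * j) = (d * (h * q)) * x"
        proof -
          have "(s * u) * (h * j) = s * h * (u * j)" by (simp add: ac_simps)
          also have "\<dots> = h * (s * c) * x" unfolding u(4) by (simp add: ac_simps)
          also have "\<dots> = (d * (h * q)) * x" unfolding s(4) by (simp add: ac_simps)
          finally show ?thesis .
        qed
        have uQ: "u \<notin> Q" using u(3) QM by auto
        have su: "s * u \<in> R" "s * u \<notin> Q"
          using mult_in[OF s(1) u(1)] prime_mult_notin[OF Qp s(1) u(1) s(3) uQ] by simp_all
        have "(d * (h * q)) * x \<in> Q" using IQ(4)[OF mult_in[OF s(2) hq] xQ] .
        then obtain w e where w: "w \<in> R" "w \<notin> N" "e \<in> Q" "w * ((d * (h * q)) * x) = e * (s * u)"
          using prime_divide_off[OF Qp Np t_maximal_valuation[OF N] True _ su] by blast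
        have "(s * u) * (w * (h * j)) = w * ((s * u) * (h * j))" by (simp add: ac_simps)
        also have "\<dots> = (s * u) * e" unfolding eq w(4) by (simp add: ac_simps)
        finally have "w * (h * j) = e" using su(2) Q0 by (metis mult_cancel_left)
        then show ?thesis unfolding in_localization_iff[OF Np] using w QR by auto
      next
        case False
        then obtain f where f: "f \<in> G" "f \<notin> N" using G(3) N by blast
        have "(h * f) * j \<in> R" using f(1) by (intro mult_in hG jR) auto
        then have "f * (h * j) \<in> R" by (simp add: ac_simps)
        then show ?thesis unfolding in_localization_iff[OF Np] using f G(2) QR by auto
      qed
    qed
    then have "h \<in> colon R J" unfolding colon_def by simp
    then have hk: "h ^ k * j \<in> J" if "j \<in> J" for k j
      using that by (induction k) (auto simp: mult.assoc trace)
    \<comment> \<open>By the definition of \<open>Q\<close>, some \<open>q ^ k * x\<close> is in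
      \<open>J\<close> up to \<open>u\<close>. Multiplying by \<open>h ^ k\<close> stays in
      \<open>J\<close>, so cancelling \<open>x\<close> by means of \<open>div\<close> puts a product
      of elements outside \<open>Q\<close> into \<open>Q\<close>.\<close>
    obtain k u where u: "u \<in> R" "u \<notin> M" "u * q ^ k * x \<in> J" using q(1) unfolding Q_def by auto
    have "u * (h * q) ^ k * x = h ^ k * (u * q ^ k * x)" by (simp add: power_mult_distrib ac_simps)
    then have "u * (h * q) ^ k * x \<in> J" using hk[OF u(3)] by (simp only:)
    then obtain v c where v: "v \<in> R" "c \<in> Q" "v \<notin> M" "v * (u * (h * q) ^ k * x) = c * x"
      using div by blast
    then have "(v * (u * (h * q) ^ k)) * x = c * x" by (simp add: mult.assoc)
    then have "v * (u * (h * q) ^ k) = c" using x0 by simp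
    moreover have "u \<notin> Q" "v \<notin> Q" using u(2) v(3) QM by auto
    then have "v * (u * (h * q) ^ k) \<notin> Q"
      using u(1) v(1) power_in[OF hq, of k] prime_power_notin[OF Qp hq hqQ, of k]
      by (intro prime_mult_notin[OF Qp] mult_in[OF u(1)])
    ultimately show False using v(2) by simp
  qed
  then show ?thesis unfolding radical_ideal_def using t_idealD(1)[OF J] by auto
qed

lemma ideal_subset_trace: "is_ideal R I \<Longrightarrow> I \<subseteq> mprod R I (colon R I)"
proof
  fix i assume I: "is_ideal R I" and i: "i \<in> I"
  have "1 \<in> colon R I" using is_idealD(1)[OF I] unfolding colon_def by auto
  then show "i \<in> mprod R I (colon R I)" using mprod_mem[OF i, of 1] by simp
qed

lemma finitely_t_supported_imp_tRTP:
  assumes supp: "\<And>P. t_prime R P \<Longrightarrow> finitely_t_supported P"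
  shows "tRTP R"
  unfolding tRTP_def
proof (intro allI impI)
  fix I assume I: "is_ideal R I \<and> I \<noteq> {0}"
  let ?A = "mprod R I (colon R I)"
  have id: "is_ideal R I" using I by simp
  have nz: "\<not> ?A \<subseteq> {0}" using ideal_subset_trace[OF id] is_idealD(2)[OF id] I by blast
  have "?A \<subseteq> R" by (intro mprod_least submod_R) (auto simp: colon_def mult.commute)
  then have "t_ideal R (t_op R ?A)" using nz by (rule t_ideal_t_op)
  then have "radical_ideal R (t_op R ?A)"
    using supp trace_colon[OF _ nz] by (intro supported_imp_trace_radical)
  then show "t_op R ?A = R \<or> radical_ideal R (t_op R ?A)" by simp
qed

lemma tRTP_imp_t_separated:
  assumes rtp: "tRTP R" and P: "t_prime R P"
  shows "t_separated P"
proof -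
  note Pp = t_primeD(1)[OF P]
  note IP = is_idealD[OF t_primeD(3)[OF P]]
  obtain a where a: "a \<in> P" "a \<noteq> 0" "\<forall>p\<in>P. \<exists>s\<in>R. \<exists>c\<in>R. s \<notin> P \<and> s * p = c * a"
    using t_prime_locally_principal[OF P] by auto
  \<comment> \<open>This is the contraction of a^2 R_P to \<open>R\<close>. It contains all products
    of two elements of \<open>P\<close> but not \<open>a\<close>.\<close>
  define I where "I = {r \<in> R. r / (a * a) \<in> localization R P}"
  have aa: "a * a \<noteq> 0" using a by simp
  have PP: "p * p' \<in> I" if pp: "p \<in> P" "p' \<in> P" for p p'
  proof -
    obtain s c where s: "s \<in> R" "c \<in> R" "s \<notin> P" "s * p = c * a" using a(3) pp by auto
    obtain s' c' where s': "s' \<in> R" "c' \<in> R" "s' \<notin> P" "s' * p' = c' * a" using a(3) pp by auto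
    have "(s * s') * (p * p' / (a * a)) = (s * p) * (s' * p') / (a * a)" by simp
    also have "\<dots> = c * c'" unfolding s(4) s'(4) using a(2) by simp
    finally have "(s * s') * (p * p' / (a * a)) \<in> R" using s s' mult_in by simp
    then have "p * p' / (a * a) \<in> localization R P"
      unfolding in_localization_iff[OF Pp] using s s' mult_in prime_mult_notin[OF Pp] by blast
    then show ?thesis unfolding I_def using pp IP(1) mult_in by auto
  qed
  have aI: "a \<notin> I"
  proof
    assume "a \<in> I"
    then obtain s where s: "s \<in> R" "s \<notin> P" "s * (a / (a * a)) \<in> R"
      unfolding I_def in_localization_iff[OF Pp] by blast
    have "(s * (a / (a * a))) * a = s" using a(2) by simp
    then have "s \<in> P" using IP(4)[OF s(3) a(1)] by (simp only:)
    then show False using s(2) by simp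
  qed
  have "submod R I"
    unfolding submod_def
  proof (intro conjI ballI)
    have "0 \<in> localization R P"
      unfolding in_localization_iff[OF Pp] using one_in zero_in t_primeD(4)[OF P] by auto
    then show "0 \<in> I" unfolding I_def using zero_in by simp
    fix r r' assume r: "r \<in> I" "r' \<in> I"
    have "\<exists>s\<in>R. s \<notin> P \<and> (\<forall>f\<in>{r / (a * a), r' / (a * a)}. s * f \<in> R)"
      using r by (intro common_denominator[OF Pp]) (auto simp: I_def)
    then obtain s where s: "s \<in> R" "s \<notin> P" "s * (r / (a * a)) \<in> R" "s * (r' / (a * a)) \<in> R" by auto
    have "s * ((r + r') / (a * a)) \<in> R"
      using add_in[OF s(3,4)] by (simp add: add_divide_distrib distrib_left)
    then have "(r + r') / (a * a) \<in> localization R P"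
      unfolding in_localization_iff[OF Pp] using s by blast
    then show "r + r' \<in> I" unfolding I_def using r add_in by (auto simp: I_def)
  next
    fix t r assume t: "t \<in> R" "r \<in> I"
    have "t \<in> localization R P"
      unfolding in_localization_iff[OF Pp] using one_in t t_primeD(4)[OF P] by auto
    then have "t * (r / (a * a)) \<in> localization R P"
      using t(2) by (intro localization_mult[OF Pp]) (auto simp: I_def)
    then show "t * r \<in> I" unfolding I_def using t mult_in by (auto simp: I_def)
  qed
  then have id: "is_ideal R I" unfolding is_ideal_def I_def by auto
  have tI: "t_ideal R I"
  proof (rule t_idealI[OF id PP[OF a(1) a(1)] aa], rule subsetI)
    fix F y assume F: "finite F" "F \<subseteq> I" and y: "y \<in> v_op R F"
    have "y / (a * a) \<in> localization R P"
      using F(2) by (intro v_op_principal_localization[OF Pp aa F(1) _ y]) (auto simp: I_def)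
    moreover have "y \<in> R" using y v_op_subset_R[of F] F(2) is_idealD(1)[OF id] by auto
    ultimately show "y \<in> I" unfolding I_def by simp
  qed
  let ?A = "mprod R I (colon R I)"
  have I0: "I \<noteq> {0}" using PP[OF a(1) a(1)] aa by auto
  have nz: "\<not> ?A \<subseteq> {0}" using ideal_subset_trace[OF id] is_idealD(2)[OF id] I0 by blast
  \<comment> \<open>The trace contains \<open>I\<close>, hence \<open>p ^ 2\<close>. Whether its
    t-closure is \<open>R\<close> or radical, \<open>p\<close> follows.\<close>
  have "p \<in> t_op R ?A" if p: "p \<in> P" for p
  proof -
    have pR: "p \<in> R" using p IP(1) by auto
    have "p ^ 2 \<in> t_op R ?A"
      using PP[OF p p] ideal_subset_trace[OF id] t_op_superset[OF nz]
      by (auto simp: power2_eq_square)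
    moreover have "t_op R ?A = R \<or> radical_ideal R (t_op R ?A)"
      using rtp id I0 unfolding tRTP_def by simp
    ultimately show ?thesis using pR unfolding radical_ideal_def by auto
  qed
  then have aA: "a \<in> t_op R ?A" using a(1) by simp
  \<comment> \<open>If (R : I) were inside R_P, it would map \<open>I\<close> into itself, and the
    t-closed trace would stay in the t-ideal \<open>I\<close>, which misses
    \<open>a\<close>.\<close>
  have "\<not> colon R I \<subseteq> localization R P"
  proof
    assume sub: "colon R I \<subseteq> localization R P"
    have "?A \<subseteq> I"
    proof (rule mprod_least[OF is_ideal_submod[OF id]])
      fix i k assume ik: "i \<in> I" "k \<in> colon R I"
      have "k * i \<in> R" using ik unfolding colon_def by auto
      moreover have "k * (i / (a * a)) \<in> localization R P"
        using ik sub by (intro localization_mult[OF Pp]) (auto simp: I_def)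
      ultimately show "i * k \<in> I" unfolding I_def by (simp add: mult.commute)
    qed
    then have "t_op R ?A \<subseteq> t_op R I" by (rule t_op_mono)
    then have "t_op R ?A \<subseteq> I" using tI unfolding t_ideal_def by simp
    then show False using aA aI by auto
  qed
  then obtain x where x: "x \<in> colon R I" "x \<notin> localization R P" by auto
  have "x \<in> localization R N" if N: "t_maximal R N" "\<not> P \<subseteq> N" for N
  proof -
    obtain p where p: "p \<in> P" "p \<notin> N" using N(2) by auto
    then have pR: "p \<in> R" using IP(1) by auto
    have "p * p \<notin> N" using prime_mult_notin[OF t_maximal_prime[OF N(1)] pR pR p(2) p(2)] .
    moreover have "(p * p) * x \<in> R"
      using x(1) PP[OF p(1) p(1)] unfolding colon_def by (auto simp: ac_simps)
    ultimately show ?thesis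
      unfolding in_localization_iff[OF t_maximal_prime[OF N(1)]] using mult_in[OF pR pR] by blast
  qed
  then show ?thesis unfolding t_separated_def using x(2) by auto
qed

end

section \<open>Joining the local conditions to the three global ones\<close>

theorem theorem1p14:
  fixes R :: "'k::field set"
  assumes "domain_with_qf R" and "R \<noteq> UNIV"
  shows "(generalized_Krull R \<longleftrightarrow> strongly_discrete_PvMD R \<and> t_sharp_sharp R)
       \<and> (strongly_discrete_PvMD R \<and> t_sharp_sharp R \<longleftrightarrow> strongly_discrete_PvMD R \<and> tRTP R)"
proof (cases "strongly_discrete_PvMD R")
  case False
  then show ?thesis unfolding generalized_Krull_def by simp
next
  case True
  then interpret strongly_discrete_domain R
    using assms by unfold_locales
  let ?rf = "\<forall>P. t_prime R P \<longrightarrow> radically_finite P"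
    and ?ts = "\<forall>P. t_prime R P \<longrightarrow> finitely_t_supported P"
    and ?sep = "\<forall>P. t_prime R P \<longrightarrow> t_separated P"
  \<comment> \<open>The implications from \<open>?sep\<close> through \<open>?ts\<close> to
    \<open>?rf\<close> are closed up by \<open>t_sharp_sharp\<close>; \<open>acc_radical_t\<close>
    is tied to \<open>?rf\<close> in both directions, and \<open>tRTP\<close> leads from
    \<open>?ts\<close> back to \<open>?sep\<close>.\<close>
  have "?sep \<longrightarrow> ?ts" using t_separated_imp_finitely_t_supported by simp
  moreover have "?ts \<longrightarrow> ?rf" using finitely_t_supported_imp_radically_finite by simp
  moreover have "?rf \<longrightarrow> acc_radical_t R" using radically_finite_imp_acc by simp
  moreover have "acc_radical_t R \<longrightarrow> ?rf" using acc_imp_radically_finite t_primeD(2) by simp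
  moreover have "?rf \<longrightarrow> t_sharp_sharp R" using radically_finite_imp_t_sharp_sharp by simp
  moreover have "t_sharp_sharp R \<longrightarrow> ?sep" using t_sharp_sharp_imp_t_separated by simp
  moreover have "?ts \<longrightarrow> tRTP R" using finitely_t_supported_imp_tRTP by simp
  moreover have "tRTP R \<longrightarrow> ?sep" using tRTP_imp_t_separated by simp
  ultimately show ?thesis unfolding generalized_Krull_def using True by argo
qed

end
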